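(* Let $X_1,\dots,X_n$ be iid from a density $p^\star=p_{\theta^\star}$ that is a finite mixture of Cauchy kernels $k(x\mid\mu)=\frac{1}{\sigma\pi}\bigl\{1+\frac{(x-\mu)^2}{\sigma^2}\bigr\}^{-1}$ with fixed known scale $\sigma>0$. Set $\varepsilon_n=(\log n)\,n^{-1/2}$, and take $S=S_n\propto n\varepsilon_n^2(\log n)^{-1}=\log n$, $B_n\propto\log^{1/2}(\varepsilon_n^{-1})$, $c=c_n=n\varepsilon_n^{-2}=n^2/(\log n)^2$, and $\delta_n\propto\varepsilon_n$. Then there exists $M>0$ such that the posterior $\Pi^n$ for the Cauchy mixture model, corresponding to the empirical prior defined in the context, satisfies, as $n\to\infty$, $$\mathsf{E}_{\theta^\star}^n\bigl[\Pi^n(\{\theta\in\Theta_n:H(p_{\theta^\star},p_\theta)>M\varepsilon_n\})\bigr]\to0.$$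
   Context: Model: for an integer $S$, $\theta=(\omega,\mu)$ with $\omega=(\omega_1,\dots,\omega_S)$ in the probability simplex $\Delta(S)=\{\omega:\omega_s\ge0,\sum_{s=1}^S\omega_s=1\}$ and $\mu=(\mu_1,\dots,\mu_S)\in\mathbb{R}^S$, put $p_\theta(x)=\sum_{s=1}^S\omega_s\,k(x\mid\mu_s)$; more generally, for a mixing probability measure $\theta$, $p_\theta(x)=\int k(x\mid\mu)\,\theta(d\mu)$. The likelihood is $L_n(\theta)=\prod_{i=1}^np_\theta(X_i)$. Empirical prior: with $S=S_n$, let $\hat\theta=(\hat\omega,\hat\mu)$ be the maximum likelihood estimator of mixture weights and locations in the $S$-component model, with the optimization restricted to $|\hat\mu_s|\le B_n$. Under the empirical prior $\Pi_n$ on $\Theta_n=\Delta(S_n)\times\mathbb{R}^{S_n}$, $\omega$ and $\mu$ are independent, $\omega\sim\mathrm{Dir}_S(\hat\alpha)$ (Dirichlet) with $\hat\alpha_s=1+c\,\hat\omega_s$, and $\mu_1,\dots,\mu_S$ are independent with $\mu_s\sim\mathrm{Unif}(\hat\mu_s-\delta_n,\hat\mu_s+\delta_n)$. The posterior is the usual one, $\Pi^n(A)=\int_AL_n\,d\Pi_n/\int_{\Theta_n}L_n\,d\Pi_n$. $a_n\propto b_n$ means $a_n=\kappa b_n$ for a fixed constant $\kappa>0$ (rounded to an integer for $S_n$). $H^2(f,g)=\frac12\int(f^{1/2}-g^{1/2})^2dx$. $\mathsf{E}_{\theta^\star}^n$ is expectation under $X_1,\dots,X_n$ iid from $p_{\theta^\star}$.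 *)

theory Defs
  imports "HOL-Probability.Probability"
begin

text \<open>A parameter is a pair of a weight vector and a location vector, both indexed by
  \<open>{..<S}\<close> and extensional outside, so that they are points of the product spaces
  \<open>PiM {..<S} (\<lambda>_. borel)\<close>.\<close>

type_synonym param = "(nat \<Rightarrow> real) \<times> (nat \<Rightarrow> real)"

definition cauchy_kernel :: "real \<Rightarrow> real \<Rightarrow> real \<Rightarrow> real" where
  "cauchy_kernel \<sigma> x \<mu> = 1 / (\<sigma> * pi) * inverse (1 + (x - \<mu>)\<^sup>2 / \<sigma>\<^sup>2)"

definition mixture :: "real \<Rightarrow> nat \<Rightarrow> param \<Rightarrow> real \<Rightarrow> real" where
  "mixture \<sigma> S \<theta> x = (\<Sum>s<S. fst \<theta> s * cauchy_kernel \<sigma> x (snd \<theta> s))"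

definition prob_simplex :: "nat \<Rightarrow> (nat \<Rightarrow> real) set" where
  "prob_simplex S =
     {\<omega> \<in> {..<S} \<rightarrow>\<^sub>E UNIV. (\<forall>s<S. 0 \<le> \<omega> s) \<and> (\<Sum>s<S. \<omega> s) = 1}"

definition param_space :: "nat \<Rightarrow> param set" where
  "param_space S = prob_simplex S \<times> ({..<S} \<rightarrow>\<^sub>E UNIV)"

definition param_measurable_space :: "nat \<Rightarrow> param measure" where
  "param_measurable_space S = PiM {..<S} (\<lambda>_. borel) \<Otimes>\<^sub>M PiM {..<S} (\<lambda>_. borel)"

definition sample_measure :: "(real \<Rightarrow> real) \<Rightarrow> nat \<Rightarrow> (nat \<Rightarrow> real) measure" where
  "sample_measure p n = PiM {..<n} (\<lambda>_. density lborel (\<lambda>x. ennreal (p x)))"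

definition likelihood :: "real \<Rightarrow> nat \<Rightarrow> nat \<Rightarrow> (nat \<Rightarrow> real) \<Rightarrow> param \<Rightarrow> real" where
  "likelihood \<sigma> S n X \<theta> = (\<Prod>i<n. mixture \<sigma> S \<theta> (X i))"

text \<open>The maximizer need not be unique (components can be relabelled), so being a maximum likelihood
  estimate is a predicate.\<close>

definition is_mle :: "real \<Rightarrow> nat \<Rightarrow> real \<Rightarrow> nat \<Rightarrow> (nat \<Rightarrow> real) \<Rightarrow> param \<Rightarrow> bool" where
  "is_mle \<sigma> S B n X \<theta> \<longleftrightarrow>
     is_arg_max (likelihood \<sigma> S n X) (\<lambda>\<theta>. \<theta> \<in> param_space S \<and> (\<forall>s<S. \<bar>snd \<theta> s\<bar> \<le> B)) \<theta>"

definition mle_estimator ::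
  "real \<Rightarrow> nat \<Rightarrow> real \<Rightarrow> (real \<Rightarrow> real) \<Rightarrow> nat \<Rightarrow> ((nat \<Rightarrow> real) \<Rightarrow> param) \<Rightarrow> bool" where
  "mle_estimator \<sigma> S B p n \<theta>hat \<longleftrightarrow>
     \<theta>hat \<in> sample_measure p n \<rightarrow>\<^sub>M param_measurable_space S \<and>
     (\<forall>X \<in> space (sample_measure p n). is_mle \<sigma> S B n X (\<theta>hat X))"

text \<open>The Dirichlet distribution for \<open>S \<ge> 1\<close> and positive \<open>\<alpha>\<close>: its usual density is taken with respect
  to Lebesgue measure on the first \<open>S - 1\<close> coordinates, the last one being determined by the others.
  The density is restricted to the open simplex because \<open>0 powr 0 = 0\<close>; the boundary is a null set.\<close>

definition simplex_point :: "nat \<Rightarrow> (nat \<Rightarrow> real) \<Rightarrow> (nat \<Rightarrow> real)" where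
  "simplex_point S u = (\<lambda>s\<in>{..<S}. if s = S - 1 then 1 - (\<Sum>r<S - 1. u r) else u s)"

definition dirichlet_density :: "nat \<Rightarrow> (nat \<Rightarrow> real) \<Rightarrow> (nat \<Rightarrow> real) \<Rightarrow> real" where
  "dirichlet_density S \<alpha> \<omega> =
     (if \<forall>s<S. 0 < \<omega> s
      then Gamma (\<Sum>s<S. \<alpha> s) / (\<Prod>s<S. Gamma (\<alpha> s)) * (\<Prod>s<S. \<omega> s powr (\<alpha> s - 1))
      else 0)"

definition dirichlet :: "nat \<Rightarrow> (nat \<Rightarrow> real) \<Rightarrow> (nat \<Rightarrow> real) measure" where
  "dirichlet S \<alpha> =
     distr
       (density (PiM {..<S - 1} (\<lambda>_. lborel))
          (\<lambda>u. ennreal (dirichlet_density S \<alpha> (simplex_point S u))))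
       (PiM {..<S} (\<lambda>_. borel))
       (simplex_point S)"

text \<open>The empirical prior centred at the estimate \<open>\<theta>hat\<close>.\<close>

definition empirical_prior :: "nat \<Rightarrow> real \<Rightarrow> real \<Rightarrow> param \<Rightarrow> param measure" where
  "empirical_prior S c \<delta> \<theta>hat =
     dirichlet S (\<lambda>s. 1 + c * fst \<theta>hat s) \<Otimes>\<^sub>M
     PiM {..<S} (\<lambda>s. uniform_measure lborel {snd \<theta>hat s - \<delta> <..< snd \<theta>hat s + \<delta>})"

definition posterior ::
  "real \<Rightarrow> nat \<Rightarrow> nat \<Rightarrow> (nat \<Rightarrow> real) \<Rightarrow> param measure \<Rightarrow> param set \<Rightarrow> ennreal" where
  "posterior \<sigma> S n X \<nu> A =
     (\<integral>\<^sup>+\<theta>\<in>A. ennreal (likelihood \<sigma> S n X \<theta>) \<partial>\<nu>) /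
     (\<integral>\<^sup>+\<theta>\<in>param_space S. ennreal (likelihood \<sigma> S n X \<theta>) \<partial>\<nu>)"

definition hellinger :: "(real \<Rightarrow> real) \<Rightarrow> (real \<Rightarrow> real) \<Rightarrow> real" where
  "hellinger f g = sqrt (1 / 2 * (\<integral>x. (sqrt (f x) - sqrt (g x))\<^sup>2 \<partial>lborel))"

definition rate :: "nat \<Rightarrow> real" where
  "rate n = ln (real n) / sqrt (real n)"

end

theory Submission
  imports Defs "HOL-Real_Asymp.Real_Asymp"
begin

text \<open>The number of components is of order \<open>ln n\<close>, so every factor \<open>n ^ O(S)\<close> is \<open>exp (O(ln\<^sup>2 n))\<close>,
  and \<open>n \<epsilon>\<^sub>n\<^sup>2 = ln\<^sup>2 n\<close>. This allows crude bounds.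

  For fixed data, the maximiser of the Dirichlet density is the estimate itself (Gibbs' inequality), so
  that up to a factor \<open>n ^ O(S)\<close> the posterior mass of a set is at most the supremum over that set
  (and over the support of the prior) of the likelihood ratio against the estimate: the numerator is
  bounded by the peak of the density, the denominator from below on a box of side about \<open>1 / (c S)\<close>
  for the weights and \<open>1 / n\<close> for the locations. The likelihood of the estimate is at least that of the
  truth, which kills the dependence of the prior on the data.

  The supremum is handled by bracketing: since shifting the location changes a Cauchy kernel by at
  most a constant factor, uniformly in \<open>x\<close>, a grid of \<open>n ^ O(S)\<close> parameters gives upper brackets \<open>u\<^sub>g\<close> of
  total mass \<open>1 + o(\<epsilon>\<^sub>n\<^sup>2)\<close>. As the posterior is at most \<open>1\<close>, it is bounded by the square root of any
  bound, and the expectation of \<open>\<Prod>i. sqrt (u\<^sub>g (X\<^sub>i) / p (X\<^sub>i))\<close> is the \<open>n\<close>-th power of the affinity of \<open>u\<^sub>g\<close>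
  and \<open>p\<close>, at most \<open>exp (- M\<^sup>2 ln\<^sup>2 n / 2)\<close> when the cell meets \<open>{H > M \<epsilon>\<^sub>n}\<close>.\<close>

section \<open>Cauchy mixtures\<close>

lemma cauchy_kernel_pos: "\<sigma> > 0 \<Longrightarrow> cauchy_kernel \<sigma> x \<mu> > 0"
  by (simp add: cauchy_kernel_def add_pos_nonneg)

lemma borel_measurable_cauchy_kernel [measurable]:
  "(\<lambda>x. cauchy_kernel \<sigma> x \<mu>) \<in> borel_measurable borel"
  unfolding cauchy_kernel_def by measurable

text \<open>The logarithm of \<open>1 + a\<^sup>2\<close> is Lipschitz in \<open>a\<close>.
  Expanding \<open>a\<^sup>2\<close> around \<open>b\<close> and using
  \<open>\<bar>2 * b\<bar> \<le> 1 + b\<^sup>2\<close> bounds the ratio by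
  \<open>1 + d + d\<^sup>2\<close> with \<open>d = \<bar>a - b\<bar>\<close>; the 2 in the exponent
  makes room for the quadratic term.\<close>

lemma one_plus_square_le_exp:
  fixes a b :: real
  shows "1 + a\<^sup>2 \<le> exp (2 * \<bar>a - b\<bar>) * (1 + b\<^sup>2)"
proof -
  define d where "d = \<bar>a - b\<bar>"
  have d: "d \<ge> 0" by (simp add: d_def)
  have "a\<^sup>2 = b\<^sup>2 + 2 * b * (a - b) + (a - b)\<^sup>2"
    by (simp add: power2_eq_square algebra_simps)
  also have "2 * b * (a - b) \<le> \<bar>2 * b\<bar> * d"
    unfolding d_def abs_mult[symmetric] by (rule abs_ge_self)
  also have "\<bar>2 * b\<bar> * d \<le> (1 + b\<^sup>2) * d"
  proof (rule mult_right_mono[OF _ d])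
    show "\<bar>2 * b\<bar> \<le> 1 + b\<^sup>2"
      using sum_squares_bound[of b 1] sum_squares_bound[of "-b" 1] by (simp add: abs_if)
  qed
  also have "(a - b)\<^sup>2 = 1 * d\<^sup>2" by (simp add: d_def)
  also have "1 * d\<^sup>2 \<le> (1 + b\<^sup>2) * d\<^sup>2" by (rule mult_right_mono) auto
  finally have "1 + a\<^sup>2 \<le> (1 + b\<^sup>2) * (1 + d + d\<^sup>2)" by (simp add: algebra_simps)
  also have "\<dots> \<le> (1 + b\<^sup>2) * exp (2 * d)"
  proof (rule mult_left_mono)
    have "1 + 2 * d + (2 * d)\<^sup>2 / 2 \<le> exp (2 * d)"
      by (rule exp_lower_Taylor_quadratic) (use d in simp)
    then show "1 + d + d\<^sup>2 \<le> exp (2 * d)"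
      using d by (simp add: power_mult_distrib) (smt (verit) zero_le_power2)
  qed simp
  finally show ?thesis by (simp add: d_def mult.commute)
qed

text \<open>After standardising, the ratio of the kernels is a ratio of two values of the polynomial
  \<open>1 + a\<^sup>2\<close>. Polynomial tails are what makes the factor independent of
  \<open>x\<close>.\<close>

lemma cauchy_kernel_shift:
  assumes "\<sigma> > 0"
  shows "cauchy_kernel \<sigma> x \<mu>' \<le> exp (2 * \<bar>\<mu> - \<mu>'\<bar> / \<sigma>) * cauchy_kernel \<sigma> x \<mu>"
proof -
  define a b where "a = (x - \<mu>) / \<sigma>" and "b = (x - \<mu>') / \<sigma>"
  have "\<bar>a - b\<bar> = \<bar>\<mu> - \<mu>'\<bar> / \<sigma>"
    using assms by (simp add: a_def b_def diff_divide_distrib[symmetric] abs_if field_simps)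
  then have *: "1 + a\<^sup>2 \<le> exp (2 * \<bar>\<mu> - \<mu>'\<bar> / \<sigma>) * (1 + b\<^sup>2)"
    using one_plus_square_le_exp[of a b] by simp
  have pos: "1 + a\<^sup>2 > 0" "1 + b\<^sup>2 > 0" by (simp_all add: add_pos_nonneg)
  have "inverse (1 + b\<^sup>2) \<le> exp (2 * \<bar>\<mu> - \<mu>'\<bar> / \<sigma>) * inverse (1 + a\<^sup>2)"
    using * pos by (simp add: field_simps)
  then have "1 / (\<sigma> * pi) * inverse (1 + b\<^sup>2)
      \<le> 1 / (\<sigma> * pi) * (exp (2 * \<bar>\<mu> - \<mu>'\<bar> / \<sigma>) * inverse (1 + a\<^sup>2))"
    using assms by (intro mult_left_mono) auto
  then show ?thesis
    by (simp add: cauchy_kernel_def a_def b_def power_divide mult_ac)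
qed

text \<open>The substitution (x - \<mu>) / \<sigma> reduces this to the integral of
  \<open>inverse (1 + x\<^sup>2)\<close> over the line, which is pi.\<close>

lemma has_bochner_integral_cauchy_kernel:
  assumes "\<sigma> > 0"
  shows "has_bochner_integral lborel (\<lambda>x. cauchy_kernel \<sigma> x \<mu>) 1"
proof -
  have "has_bochner_integral lborel (\<lambda>x::real. inverse (1 + x\<^sup>2)) pi"
    using integrable_inverse_1_plus_square LBINT_inverse_1_plus_square
    by (simp add: has_bochner_integral_iff interval_lebesgue_integral_def
        set_integrable_def set_lebesgue_integral_def)
  then have "has_bochner_integral lborel
      (\<lambda>x. inverse (1 + (- \<mu> / \<sigma> + 1 / \<sigma> * x)\<^sup>2)) (pi /\<^sub>R \<bar>1 / \<sigma>\<bar>)"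
    using assms by (subst lborel_has_bochner_integral_real_affine_iff[symmetric]) auto
  then have "has_bochner_integral lborel
      (\<lambda>x. 1 / (\<sigma> * pi) * inverse (1 + (- \<mu> / \<sigma> + 1 / \<sigma> * x)\<^sup>2))
      (1 / (\<sigma> * pi) * (pi /\<^sub>R \<bar>1 / \<sigma>\<bar>))"
    by (rule has_bochner_integral_mult_right)
  moreover have "(- \<mu> / \<sigma> + 1 / \<sigma> * x)\<^sup>2 = (x - \<mu>)\<^sup>2 / \<sigma>\<^sup>2" for x
    using assms by (simp add: power_divide[symmetric] diff_divide_distrib)
  moreover have "1 / (\<sigma> * pi) * (pi /\<^sub>R \<bar>1 / \<sigma>\<bar>) = 1"
    using assms by simp
  ultimately show ?thesis by (simp add: cauchy_kernel_def)
qed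

section \<open>Mixtures: total mass, positivity and comparison\<close>

lemma has_bochner_integral_mixture:
  assumes "\<sigma> > 0"
  shows "has_bochner_integral lborel (mixture \<sigma> S \<theta>) (\<Sum>s<S. fst \<theta> s)"
proof -
  have "has_bochner_integral lborel (\<lambda>x. \<Sum>s<S. fst \<theta> s * cauchy_kernel \<sigma> x (snd \<theta> s))
      (\<Sum>s<S. fst \<theta> s * 1)"
    by (intro has_bochner_integral_sum has_bochner_integral_mult_right
        has_bochner_integral_cauchy_kernel assms)
  then show ?thesis by (simp add: mixture_def[abs_def])
qed

lemma borel_measurable_mixture [measurable]: "mixture \<sigma> S \<theta> \<in> borel_measurable borel"
  unfolding mixture_def[abs_def] by measurable

lemma param_space_nonneg: "\<theta> \<in> param_space S \<Longrightarrow> s < S \<Longrightarrow> 0 \<le> fst \<theta> s"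
  by (simp add: param_space_def prob_simplex_def mem_Times_iff)

lemma param_space_sum: "\<theta> \<in> param_space S \<Longrightarrow> (\<Sum>s<S. fst \<theta> s) = 1"
  by (simp add: param_space_def prob_simplex_def mem_Times_iff)

lemma mixture_pos:
  assumes "\<sigma> > 0" and "\<theta> \<in> param_space S"
  shows "0 < mixture \<sigma> S \<theta> x"
proof -
  note nonneg = param_space_nonneg[OF assms(2)] and one = param_space_sum[OF assms(2)]
  obtain s where s: "s < S" "fst \<theta> s \<noteq> 0"
    using one by (metis lessThan_iff sum.neutral zero_neq_one)
  have "0 < fst \<theta> s * cauchy_kernel \<sigma> x (snd \<theta> s)"
    using nonneg[OF s(1)] s(2) cauchy_kernel_pos[OF assms(1)] by simp
  then show ?thesis
    unfolding mixture_def using nonneg s cauchy_kernel_pos[OF assms(1)]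
    by (intro sum_pos2[of _ s]) (simp_all add: less_imp_le)
qed

text \<open>Weights and locations contribute separate factors. The case \<open>a = 1\<close> yields
  the upper brackets; \<open>a = 1 / (1 - 1 / c)\<close> yields the lower bound on the likelihood
  near the estimate. The weights of \<open>\<theta>'\<close> may sum to more than 1, as they do at a
  grid point.\<close>

lemma mixture_le_mixture:
  assumes "\<sigma> > 0" and "0 \<le> a"
    and "\<And>s. s < S \<Longrightarrow> 0 \<le> fst \<theta> s \<and> fst \<theta> s \<le> a * fst \<theta>' s"
    and "\<And>s. s < S \<Longrightarrow> \<bar>snd \<theta>' s - snd \<theta> s\<bar> \<le> \<eta>"
  shows "mixture \<sigma> S \<theta> x \<le> a * exp (2 * \<eta> / \<sigma>) * mixture \<sigma> S \<theta>' x"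
  unfolding mixture_def sum_distrib_left
proof (rule sum_mono)
  fix s assume "s \<in> {..<S}"
  then have s: "s < S" by simp
  have "cauchy_kernel \<sigma> x (snd \<theta> s)
      \<le> exp (2 * \<bar>snd \<theta>' s - snd \<theta> s\<bar> / \<sigma>) * cauchy_kernel \<sigma> x (snd \<theta>' s)"
    by (rule cauchy_kernel_shift[OF assms(1)])
  also have "\<dots> \<le> exp (2 * \<eta> / \<sigma>) * cauchy_kernel \<sigma> x (snd \<theta>' s)"
    using assms(1) assms(4)[OF s] cauchy_kernel_pos[OF assms(1), of x "snd \<theta>' s"]
    by (intro mult_right_mono) (auto simp: divide_right_mono)
  finally have k: "cauchy_kernel \<sigma> x (snd \<theta> s) \<le> exp (2 * \<eta> / \<sigma>) * cauchy_kernel \<sigma> x (snd \<theta>' s)" .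
  have "fst \<theta> s * cauchy_kernel \<sigma> x (snd \<theta> s)
      \<le> (a * fst \<theta>' s) * (exp (2 * \<eta> / \<sigma>) * cauchy_kernel \<sigma> x (snd \<theta>' s))"
    using assms(3)[OF s] cauchy_kernel_pos[OF assms(1), of x] k
    by (intro mult_mono) (auto intro: less_imp_le)
  then show "fst \<theta> s * cauchy_kernel \<sigma> x (snd \<theta> s)
      \<le> a * exp (2 * \<eta> / \<sigma>) * (fst \<theta>' s * cauchy_kernel \<sigma> x (snd \<theta>' s))"
    by (simp add: mult_ac)
qed

section \<open>Mass bounds for the Dirichlet prior\<close>

text \<open>The maximum of the Dirichlet density with parameters \<open>1 + c * \<omega> s\<close>, attained at \<open>\<omega>\<close>. The factor
  \<open>\<Prod>s. \<omega> s powr (c * \<omega> s)\<close> is written with \<open>exp\<close> because \<open>0 powr 0 = 0\<close>.\<close>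

definition dirichlet_mode :: "nat \<Rightarrow> real \<Rightarrow> (nat \<Rightarrow> real) \<Rightarrow> real" where
  "dirichlet_mode S c \<omega> =
     Gamma (\<Sum>s<S. 1 + c * \<omega> s) / (\<Prod>s<S. Gamma (1 + c * \<omega> s)) * exp (c * (\<Sum>s<S. \<omega> s * ln (\<omega> s)))"

lemma dirichlet_mode_pos:
  assumes "S \<ge> 1" and "c \<ge> 0" and "\<And>s. s < S \<Longrightarrow> 0 \<le> \<omega> s"
  shows "0 < dirichlet_mode S c \<omega>"
proof -
  have 1: "0 < 1 + c * \<omega> s" if "s < S" for s
    using assms that by (simp add: add_pos_nonneg)
  have "0 < (\<Sum>s<S. 1 + c * \<omega> s)"
    using assms(1) 1 by (intro sum_pos) (auto simp: lessThan_empty_iff)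
  moreover have "0 < (\<Prod>s<S. Gamma (1 + c * \<omega> s))"
    using 1 by (intro prod_pos) (auto intro: Gamma_real_pos)
  ultimately show ?thesis
    unfolding dirichlet_mode_def by (intro mult_pos_pos divide_pos_pos Gamma_real_pos) auto
qed

text \<open>For probability vectors the exponent is \<open>- c\<close> times the Kullback-Leibler
  divergence KL(\<omega>' || \<omega>), so the density is its peak value damped by that divergence.
  Coordinates with \<open>\<omega>' s = 0\<close> add nothing to the sum.\<close>

lemma dirichlet_density_eq:
  assumes "S \<ge> 1" and "\<And>s. s < S \<Longrightarrow> 0 < \<omega> s"
  shows "dirichlet_density S (\<lambda>s. 1 + c * \<omega>' s) \<omega>
    = dirichlet_mode S c \<omega>' * exp (c * (\<Sum>s<S. \<omega>' s * (ln (\<omega> s) - ln (\<omega>' s))))"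
proof -
  have "(\<Prod>s<S. \<omega> s powr (c * \<omega>' s)) = exp (\<Sum>s<S. c * \<omega>' s * ln (\<omega> s))"
    unfolding exp_sum[OF finite_lessThan]
    by (intro prod.cong refl) (use assms(2) in \<open>simp add: powr_def less_imp_neq[THEN not_sym]\<close>)
  also have "\<dots> = exp (c * (\<Sum>s<S. \<omega>' s * ln (\<omega>' s)))
      * exp (c * (\<Sum>s<S. \<omega>' s * (ln (\<omega> s) - ln (\<omega>' s))))"
    unfolding exp_add[symmetric] distrib_left[symmetric] sum.distrib[symmetric]
    by (simp add: sum_distrib_left mult.assoc right_diff_distrib)
  finally show ?thesis
    using assms(2) by (simp add: dirichlet_density_def dirichlet_mode_def)
qed

text \<open>Termwise from ln x \<le> x - 1 at x = \<omega> s / \<omega>' s, after which both sums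
  cancel. Terms with \<open>\<omega>' s = 0\<close> are treated separately, since the ratio is then
  meaningless.\<close>

lemma gibbs_inequality:
  fixes \<omega> \<omega>' :: "'a \<Rightarrow> real"
  assumes "\<And>s. s \<in> A \<Longrightarrow> 0 < \<omega> s" and "\<And>s. s \<in> A \<Longrightarrow> 0 \<le> \<omega>' s"
    and "sum \<omega> A = sum \<omega>' A"
  shows "(\<Sum>s\<in>A. \<omega>' s * (ln (\<omega> s) - ln (\<omega>' s))) \<le> 0"
proof -
  have "(\<Sum>s\<in>A. \<omega>' s * (ln (\<omega> s) - ln (\<omega>' s))) \<le> (\<Sum>s\<in>A. \<omega> s - \<omega>' s)"
  proof (rule sum_mono)
    fix s assume s: "s \<in> A"
    show "\<omega>' s * (ln (\<omega> s) - ln (\<omega>' s)) \<le> \<omega> s - \<omega>' s"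
    proof (cases "\<omega>' s = 0")
      case True
      then show ?thesis using assms(1)[OF s] by simp
    next
      case False
      then have pos: "\<omega>' s > 0" using assms(2)[OF s] by simp
      have "ln (\<omega> s) - ln (\<omega>' s) = ln (\<omega> s / \<omega>' s)"
        using pos assms(1)[OF s] by (simp add: ln_div)
      also have "\<dots> \<le> \<omega> s / \<omega>' s - 1"
        using pos assms(1)[OF s] by (intro ln_le_minus_one) simp
      finally have "\<omega>' s * (ln (\<omega> s) - ln (\<omega>' s)) \<le> \<omega>' s * (\<omega> s / \<omega>' s - 1)"
        using pos by (intro mult_left_mono) auto
      then show ?thesis using pos by (simp add: algebra_simps)
    qed
  qed
  then show ?thesis using assms(3) by (simp add: sum_subtractf)
qed

text \<open>On the open simplex the exponent is nonpositive by Gibbs' inequality; elsewhere the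
  density is zero by definition.\<close>

lemma dirichlet_density_le_mode:
  assumes "S \<ge> 1" and "c \<ge> 0" and "\<omega>' \<in> prob_simplex S" and "(\<Sum>s<S. \<omega> s) = 1"
  shows "dirichlet_density S (\<lambda>s. 1 + c * \<omega>' s) \<omega> \<le> dirichlet_mode S c \<omega>'"
proof (cases "\<forall>s<S. 0 < \<omega> s")
  case True
  have nn: "\<And>s. s < S \<Longrightarrow> 0 \<le> \<omega>' s" and one: "(\<Sum>s<S. \<omega>' s) = 1"
    using assms(3) by (simp_all add: prob_simplex_def)
  have "(\<Sum>s<S. \<omega>' s * (ln (\<omega> s) - ln (\<omega>' s))) \<le> 0"
    using True nn one assms(4) by (intro gibbs_inequality) auto
  then have "exp (c * (\<Sum>s<S. \<omega>' s * (ln (\<omega> s) - ln (\<omega>' s)))) \<le> 1"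
    using assms(2) by (simp add: mult_nonneg_nonpos)
  then show ?thesis
    using True assms(1) dirichlet_mode_pos[OF assms(1,2) nn]
    by (subst dirichlet_density_eq) (auto simp: mult_le_cancel_left1)
next
  case False
  then have "dirichlet_density S (\<lambda>s. 1 + c * \<omega>' s) \<omega> = 0"
    unfolding dirichlet_density_def by (rule if_not_P)
  then show ?thesis
    using dirichlet_mode_pos[OF assms(1,2), of \<omega>'] assms(3) by (simp add: prob_simplex_def)
qed

text \<open>From ln (1 - x) \<ge> - x - 2 x^2 at x = 1 / c, where 2 x^2 \<le> x because c \<ge> 2.
  It means that up to \<open>c\<close> factors \<open>1 - 1 / c\<close> cost at most
  \<open>exp (- 2)\<close>.\<close>

lemma ln_one_minus_inverse_ge:
  fixes c :: real
  assumes "c \<ge> 2"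
  shows "- 2 / c \<le> ln (1 - 1 / c)"
proof -
  have "2 * (1 / c)\<^sup>2 \<le> 1 / c"
    using assms by (simp add: power2_eq_square field_simps)
  then show ?thesis
    using ln_one_minus_pos_lower_bound[of "1 / c"] assms by simp
qed

text \<open>Each logarithmic difference is at least - 2 / c, hence so is its average under
  \<open>\<omega>'\<close>, and multiplication by \<open>c\<close> leaves the constant - 2. The
  tolerance 1 / c is relative and one-sided: only a loss of weight lowers the density.\<close>

lemma dirichlet_density_ge_mode:
  assumes "S \<ge> 1" and "c \<ge> 2" and "\<omega>' \<in> prob_simplex S"
    and pos: "\<And>s. s < S \<Longrightarrow> 0 < \<omega> s" and ge: "\<And>s. s < S \<Longrightarrow> (1 - 1 / c) * \<omega>' s \<le> \<omega> s"
  shows "dirichlet_mode S c \<omega>' * exp (- 2) \<le> dirichlet_density S (\<lambda>s. 1 + c * \<omega>' s) \<omega>"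
proof -
  have nn: "\<And>s. s < S \<Longrightarrow> 0 \<le> \<omega>' s" and one: "(\<Sum>s<S. \<omega>' s) = 1"
    using assms(3) by (simp_all add: prob_simplex_def)
  have "- 2 / c = (\<Sum>s<S. \<omega>' s * (- 2 / c))"
    unfolding sum_distrib_right[symmetric] one by simp
  also have "\<dots> \<le> (\<Sum>s<S. \<omega>' s * (ln (\<omega> s) - ln (\<omega>' s)))"
  proof (rule sum_mono)
    fix s assume "s \<in> {..<S}"
    then have s: "s < S" by simp
    show "\<omega>' s * (- 2 / c) \<le> \<omega>' s * (ln (\<omega> s) - ln (\<omega>' s))"
    proof (cases "\<omega>' s = 0")
      case False
      then have p: "\<omega>' s > 0" using nn[OF s] by simp
      have q: "1 - 1 / c > 0" using assms(2) by simp
      have "ln (1 - 1 / c) + ln (\<omega>' s) = ln ((1 - 1 / c) * \<omega>' s)"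
        using p q by (simp only: ln_mult_pos)
      also have "\<dots> \<le> ln (\<omega> s)"
        using ge[OF s] pos[OF s] p q by simp
      finally have "- 2 / c \<le> ln (\<omega> s) - ln (\<omega>' s)"
        using ln_one_minus_inverse_ge[OF assms(2)] by simp
      then show ?thesis using p by (intro mult_left_mono) auto
    qed simp
  qed
  finally have "c * (- 2 / c) \<le> c * (\<Sum>s<S. \<omega>' s * (ln (\<omega> s) - ln (\<omega>' s)))"
    using assms(2) by (intro mult_left_mono) auto
  then have "exp (- 2) \<le> exp (c * (\<Sum>s<S. \<omega>' s * (ln (\<omega> s) - ln (\<omega>' s))))"
    using assms(2) by simp
  then show ?thesis
    using dirichlet_mode_pos[OF assms(1) _ nn, of c] assms(2) pos assms(1)
    by (subst dirichlet_density_eq) auto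
qed

lemma sum_simplex_point:
  assumes "S \<ge> 1"
  shows "(\<Sum>s<S. simplex_point S u s) = 1"
proof -
  obtain m where m: "S = Suc m" using assms by (cases S) auto
  have "(\<Sum>s<m. simplex_point S u s) = (\<Sum>s<m. u s)"
    by (intro sum.cong) (auto simp: m simplex_point_def)
  then show ?thesis by (simp add: m) (simp add: simplex_point_def)
qed

section \<open>Measurability and the Dirichlet mass as a Lebesgue integral\<close>

lemma measurable_simplex_point [measurable]:
  "simplex_point S \<in> PiM {..<S - 1} (\<lambda>_. lborel) \<rightarrow>\<^sub>M PiM {..<S} (\<lambda>_. borel)"
  unfolding simplex_point_def
proof (rule measurable_restrict)
  fix s assume "s \<in> {..<S}"
  have comp: "(\<lambda>u. u r) \<in> borel_measurable (PiM {..<S - 1} (\<lambda>_. lborel))" if "r < S - 1" for r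
    using measurable_component_singleton[of r "{..<S - 1}" "\<lambda>_. lborel :: real measure"] that by simp
  show "(\<lambda>u. if s = S - 1 then 1 - (\<Sum>r<S - 1. u r) else u s)
      \<in> borel_measurable (PiM {..<S - 1} (\<lambda>_. lborel))"
    using \<open>s \<in> {..<S}\<close> by (cases "s = S - 1") (auto intro!: borel_measurable_diff borel_measurable_sum comp)
qed

lemma measurable_dirichlet_density [measurable]:
  "dirichlet_density S \<alpha> \<in> borel_measurable (PiM {..<S} (\<lambda>_. borel))"
proof -
  have [measurable]: "(\<lambda>\<omega>. \<omega> s) \<in> borel_measurable (PiM {..<S} (\<lambda>_. borel :: real measure))"
    if "s \<in> {..<S}" for s using that by measurable
  have [measurable]: "Measurable.pred (PiM {..<S} (\<lambda>_. borel :: real measure)) (\<lambda>\<omega>. \<forall>s\<in>{..<S}. 0 < \<omega> s)"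
    by (rule pred_intros_finite) auto
  have "(\<lambda>\<omega>. if \<forall>s\<in>{..<S}. 0 < \<omega> s
      then Gamma (\<Sum>s<S. \<alpha> s) / (\<Prod>s<S. Gamma (\<alpha> s)) * (\<Prod>s<S. \<omega> s powr (\<alpha> s - 1)) else 0)
      \<in> borel_measurable (PiM {..<S} (\<lambda>_. borel))"
    by measurable
  then show ?thesis by (simp add: dirichlet_density_def[abs_def] Ball_def)
qed

lemma sets_dirichlet [simp, measurable_cong]: "sets (dirichlet S \<alpha>) = sets (PiM {..<S} (\<lambda>_. borel))"
  by (simp add: dirichlet_def)

lemma space_dirichlet [simp]: "space (dirichlet S \<alpha>) = ({..<S} \<rightarrow>\<^sub>E UNIV)"
  by (simp add: dirichlet_def space_PiM)

lemma emeasure_dirichlet: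
  assumes "D \<in> sets (PiM {..<S} (\<lambda>_. borel))"
  shows "emeasure (dirichlet S \<alpha>) D =
    (\<integral>\<^sup>+u. ennreal (dirichlet_density S \<alpha> (simplex_point S u)) * indicator D (simplex_point S u)
      \<partial>PiM {..<S - 1} (\<lambda>_. lborel))"
proof -
  let ?P = "PiM {..<S - 1} (\<lambda>_. lborel :: real measure)"
  have "simplex_point S -` D \<inter> space ?P \<in> sets ?P"
    using measurable_simplex_point assms by (rule measurable_sets)
  then show ?thesis
    using assms measurable_simplex_point[of S] unfolding dirichlet_def
    by (subst emeasure_distr)
       (auto simp: emeasure_density simp del: One_nat_def
         intro!: nn_integral_cong split: split_indicator)
qed

lemma emeasure_lborel_box:
  fixes a :: "nat \<Rightarrow> real"
  assumes "\<eta> \<ge> 0"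
  shows "emeasure (PiM {..<k} (\<lambda>_. lborel)) (\<Pi>\<^sub>E s\<in>{..<k}. {a s<..<a s + \<eta>}) = ennreal (\<eta> ^ k)"
proof -
  interpret product_sigma_finite "\<lambda>_::nat. lborel :: real measure" ..
  show ?thesis
    using assms by (subst emeasure_PiM) (simp_all add: ennreal_power)
qed

text \<open>Peak of the density times the volume of the unit cube, which contains all
  \<open>u\<close> whose \<open>simplex_point\<close> has positive coordinates.\<close>

lemma emeasure_dirichlet_le_mode:
  assumes "S \<ge> 1" and "c \<ge> 0" and "\<omega>' \<in> prob_simplex S"
  shows "emeasure (dirichlet S (\<lambda>s. 1 + c * \<omega>' s)) (space (dirichlet S (\<lambda>s. 1 + c * \<omega>' s)))
    \<le> ennreal (dirichlet_mode S c \<omega>')"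
proof -
  let ?dens = "\<lambda>u. dirichlet_density S (\<lambda>s. 1 + c * \<omega>' s) (simplex_point S u)"
  \<comment> \<open>The endpoint is written \<open>0 + 1\<close> to match the shape of
    \<open>emeasure_lborel_box\<close>.\<close>
  let ?cube = "\<Pi>\<^sub>E s\<in>{..<S - 1}. {(0::real)<..<0 + 1}"
  let ?P = "PiM {..<S - 1} (\<lambda>_. lborel :: real measure)"
  have "emeasure (dirichlet S (\<lambda>s. 1 + c * \<omega>' s)) (space (dirichlet S (\<lambda>s. 1 + c * \<omega>' s)))
      = (\<integral>\<^sup>+u. ennreal (?dens u) * indicator (space (PiM {..<S} (\<lambda>_. borel))) (simplex_point S u) \<partial>?P)"
    by (subst emeasure_dirichlet) (auto simp: space_PiM sets_PiM_I_finite simp del: One_nat_def)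
  also have "\<dots> \<le> (\<integral>\<^sup>+u. ennreal (dirichlet_mode S c \<omega>') * indicator ?cube u \<partial>?P)"
  proof (rule nn_integral_mono)
    fix u assume u: "u \<in> space ?P"
    show "ennreal (?dens u) * indicator (space (PiM {..<S} (\<lambda>_. borel))) (simplex_point S u)
        \<le> ennreal (dirichlet_mode S c \<omega>') * indicator ?cube u"
    proof (cases "\<forall>s<S. 0 < simplex_point S u s")
      case True
      have pos: "0 < u s" if "s < S - 1" for s
        using True[rule_format, of s] that by (simp add: simplex_point_def)
      have "0 < simplex_point S u (S - 1)" using True assms(1) by simp
      then have "(\<Sum>s<S - 1. u s) < 1" using assms(1) by (simp add: simplex_point_def)
      moreover have "u s \<le> (\<Sum>s<S - 1. u s)" if "s < S - 1" for s
        using that pos by (intro member_le_sum) (auto intro: less_imp_le)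
      ultimately have "u s < 1" if "s < S - 1" for s using that by fastforce
      then have "u \<in> ?cube" using pos u by (auto simp: space_PiM PiE_def Pi_def)
      moreover have "?dens u \<le> dirichlet_mode S c \<omega>'"
        by (intro dirichlet_density_le_mode assms sum_simplex_point)
      ultimately show ?thesis
        by (auto split: split_indicator intro: ennreal_leI)
    next
      case False
      then have "?dens u = 0" unfolding dirichlet_density_def by (rule if_not_P)
      then show ?thesis by simp
    qed
  qed
  also have "\<dots> = ennreal (dirichlet_mode S c \<omega>')"
    by (subst nn_integral_cmult_indicator)
       (use emeasure_lborel_box[of 1 "S - 1" "\<lambda>_. 0"] in \<open>auto intro!: sets_PiM_I_finite\<close>)
  finally show ?thesis .
qed

text \<open>Weights on which the density is within a factor \<open>exp (- 2)\<close> of its peak and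
  the likelihood within a constant factor of that of the estimate, provided the locations are close
  too.\<close>

definition weight_neighbourhood :: "nat \<Rightarrow> real \<Rightarrow> (nat \<Rightarrow> real) \<Rightarrow> (nat \<Rightarrow> real) set" where
  "weight_neighbourhood S c \<omega>' =
     {\<omega> \<in> space (PiM {..<S} (\<lambda>_. borel)).
        (\<forall>s\<in>{..<S}. 0 < \<omega> s \<and> (1 - 1 / c) * \<omega>' s \<le> \<omega> s) \<and> (\<Sum>s<S. \<omega> s) = 1}"

lemma sets_weight_neighbourhood [measurable]:
  "weight_neighbourhood S c \<omega>' \<in> sets (PiM {..<S} (\<lambda>_. borel))"
proof -
  have [measurable]: "(\<lambda>\<omega>. \<omega> s) \<in> borel_measurable (PiM {..<S} (\<lambda>_. borel :: real measure))"
    if "s \<in> {..<S}" for s using that by measurable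
  have [measurable]: "Measurable.pred (PiM {..<S} (\<lambda>_. borel :: real measure))
      (\<lambda>\<omega>. \<forall>s\<in>{..<S}. 0 < \<omega> s \<and> (1 - 1 / c) * \<omega>' s \<le> \<omega> s)"
    by (rule pred_intros_finite) auto
  show ?thesis unfolding weight_neighbourhood_def by measurable
qed

text \<open>Shrinking \<open>\<omega>'\<close> by the factor \<open>1 - 1 / c\<close> frees mass 1 /
  c. The first \<open>S - 1\<close> coordinates may each take up to 1 / (c S) of it, which gives the
  box; the last coordinate keeps the remainder.\<close>

lemma emeasure_dirichlet_ge_mode:
  assumes "S \<ge> 1" and "c \<ge> 2" and "\<omega>' \<in> prob_simplex S"
  shows "ennreal (dirichlet_mode S c \<omega>' * exp (- 2) * (1 / (c * real S)) ^ (S - 1))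
    \<le> emeasure (dirichlet S (\<lambda>s. 1 + c * \<omega>' s)) (weight_neighbourhood S c \<omega>')"
proof -
  let ?dens = "\<lambda>u. dirichlet_density S (\<lambda>s. 1 + c * \<omega>' s) (simplex_point S u)"
  let ?a = "\<lambda>s. (1 - 1 / c) * \<omega>' s"
  let ?\<eta> = "1 / (c * real S)"
  let ?box = "\<Pi>\<^sub>E s\<in>{..<S - 1}. {?a s<..<?a s + ?\<eta>}"
  let ?P = "PiM {..<S - 1} (\<lambda>_. lborel :: real measure)"
  have nn: "\<And>s. s < S \<Longrightarrow> 0 \<le> \<omega>' s" and one: "(\<Sum>s<S. \<omega>' s) = 1"
    using assms(3) by (simp_all add: prob_simplex_def)
  have mode: "0 < dirichlet_mode S c \<omega>'"
    using dirichlet_mode_pos[OF assms(1) _ nn, of c] assms(2) by simp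
  have "ennreal (dirichlet_mode S c \<omega>' * exp (- 2) * ?\<eta> ^ (S - 1))
      = (\<integral>\<^sup>+u. ennreal (dirichlet_mode S c \<omega>' * exp (- 2)) * indicator ?box u \<partial>?P)"
    using mode assms emeasure_lborel_box[of ?\<eta> "S - 1" ?a]
    by (subst nn_integral_cmult_indicator)
       (auto intro!: sets_PiM_I_finite simp: ennreal_mult[symmetric])
  also have "\<dots> \<le> (\<integral>\<^sup>+u. ennreal (?dens u) * indicator (weight_neighbourhood S c \<omega>') (simplex_point S u) \<partial>?P)"
  proof (rule nn_integral_mono)
    fix u assume u: "u \<in> space ?P"
    show "ennreal (dirichlet_mode S c \<omega>' * exp (- 2)) * indicator ?box u
        \<le> ennreal (?dens u) * indicator (weight_neighbourhood S c \<omega>') (simplex_point S u)"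
    proof (cases "u \<in> ?box")
      case True
      then have box: "?a s < u s" "u s < ?a s + ?\<eta>" if "s < S - 1" for s
        using that by (auto simp: PiE_def Pi_def)
      have a0: "0 \<le> ?a s" if "s < S" for s using nn[OF that] assms(2) by simp
      obtain m where m: "S = Suc m" using assms(1) by (cases S) auto
      have "(\<Sum>s<m. u s) \<le> (\<Sum>s<m. ?a s + ?\<eta>)"
        using box m by (intro sum_mono) (auto intro: less_imp_le)
      also have "\<dots> = (1 - 1 / c) * (\<Sum>s<m. \<omega>' s) + real m * ?\<eta>"
        by (simp add: sum.distrib sum_distrib_left)
      also have "(\<Sum>s<m. \<omega>' s) = 1 - \<omega>' m" using one m by simp
      also have "real m * ?\<eta> < real S * ?\<eta>"
        using m assms(2) by (intro mult_strict_right_mono) auto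
      also have "real S * ?\<eta> = 1 / c" using m by simp
      finally have last: "?a m < 1 - (\<Sum>s<m. u s)" by (simp add: algebra_simps)
      have gt: "?a s < simplex_point S u s" if "s < S" for s
        using that last box[of s] m by (cases "s = m") (auto simp: simplex_point_def)
      have pos: "0 < simplex_point S u s" if "s < S" for s
        using gt[OF that] a0[OF that] by linarith
      have "simplex_point S u \<in> space (PiM {..<S} (\<lambda>_. borel))"
        using measurable_space[OF measurable_simplex_point u] .
      then have mem: "simplex_point S u \<in> weight_neighbourhood S c \<omega>'"
        unfolding weight_neighbourhood_def using gt pos sum_simplex_point[OF assms(1)]
        by (auto intro: less_imp_le)
      have "dirichlet_mode S c \<omega>' * exp (- 2) \<le> ?dens u"
        using assms pos gt by (intro dirichlet_density_ge_mode) (auto intro: less_imp_le)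
      then show ?thesis using mem by (auto split: split_indicator intro: ennreal_leI)
    qed auto
  qed
  also have "\<dots> = emeasure (dirichlet S (\<lambda>s. 1 + c * \<omega>' s)) (weight_neighbourhood S c \<omega>')"
    by (rule emeasure_dirichlet[symmetric]) measurable
  finally show ?thesis .
qed

section \<open>Bounding the posterior by a likelihood ratio\<close>

lemma posterior_le_1:
  assumes "A \<subseteq> param_space S"
  shows "posterior \<sigma> S n X \<nu> A \<le> 1"
proof -
  let ?N = "\<integral>\<^sup>+\<theta>\<in>A. ennreal (likelihood \<sigma> S n X \<theta>) \<partial>\<nu>"
  let ?D = "\<integral>\<^sup>+\<theta>\<in>param_space S. ennreal (likelihood \<sigma> S n X \<theta>) \<partial>\<nu>"
  have "?N \<le> ?D"
    using assms by (intro nn_integral_mono) (auto split: split_indicator)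
  then have "?N / ?D \<le> ?D / ?D" by (rule divide_right_mono_ennreal)
  \<comment> \<open>In \<open>ennreal\<close>, both \<open>0 / 0\<close> and
    \<open>top / top\<close> are 0, so degenerate normalising integrals obey the bound as
    well.\<close>
  also have "\<dots> \<le> 1"
    by (cases "?D = 0 \<or> ?D = top") (auto simp: less_top[symmetric] ennreal_divide_self)
  finally show ?thesis by (simp add: posterior_def)
qed

lemma divide_le_ennreal:
  assumes "N \<le> ennreal a" and "ennreal b \<le> D" and "0 \<le> a" and "0 < b"
  shows "N / D \<le> ennreal (a / b)"
proof -
  have "N \<le> ennreal (a / b) * ennreal b"
    using assms(1,3,4) by (simp add: ennreal_mult[symmetric])
  also have "\<dots> \<le> ennreal (a / b) * D" using assms(2) by (intro mult_left_mono) auto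
  finally have "N \<le> ennreal (a / b) * D" .
  moreover have "0 < D" using assms(2,4) by (metis ennreal_less_zero_iff less_le_trans)
  ultimately show ?thesis by (intro divide_le_posI_ennreal) (simp_all add: mult.commute)
qed

section \<open>The uniform location prior\<close>

lemma prob_space_uniform_interval:
  fixes a :: real
  assumes "\<delta> > 0"
  shows "prob_space (uniform_measure lborel {a - \<delta><..<a + \<delta>})"
  using assms by (intro prob_space_uniform_measure) auto

lemma emeasure_uniform_box:
  assumes "0 < r" and "r \<le> \<delta>"
  shows "emeasure (PiM {..<S} (\<lambda>s. uniform_measure lborel {m s - \<delta><..<m s + \<delta>}))
      (\<Pi>\<^sub>E s\<in>{..<S}. {m s - r<..<m s + r}) = ennreal ((r / \<delta>) ^ S)"
proof -
  interpret product_prob_space "\<lambda>s. uniform_measure lborel {m s - \<delta><..<m s + \<delta> :: real}"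
    unfolding product_prob_space_def product_prob_space_axioms_def product_sigma_finite_def
    using assms prob_space_uniform_interval[of \<delta>]
    by (auto intro: prob_space_imp_sigma_finite)
  have "{m s - \<delta><..<m s + \<delta>} \<inter> {m s - r<..<m s + r} = {m s - r<..<m s + r}" for s
    using assms by auto
  then have "emeasure (uniform_measure lborel {m s - \<delta><..<m s + \<delta>}) {m s - r<..<m s + r}
      = ennreal (r / \<delta>)" for s
    using assms by (simp add: divide_ennreal)
  then show ?thesis
    using assms by (subst emeasure_PiM) (auto simp: ennreal_power)
qed

lemma AE_uniform_box:
  fixes m :: "nat \<Rightarrow> real"
  assumes "\<delta> > 0"
  shows "AE y in PiM {..<S} (\<lambda>s. uniform_measure lborel {m s - \<delta><..<m s + \<delta>}).
    \<forall>s\<in>{..<S}. \<bar>y s - m s\<bar> < \<delta>"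
proof (rule AE_finite_allI[OF finite_lessThan])
  fix s assume s: "s \<in> {..<S}"
  have "AE x in uniform_measure lborel {m s - \<delta><..<m s + \<delta>}. \<bar>x - m s\<bar> < \<delta>"
    by (rule AE_uniform_measureI) (auto simp: abs_less_iff)
  then show "AE y in PiM {..<S} (\<lambda>s. uniform_measure lborel {m s - \<delta><..<m s + \<delta>}).
      \<bar>y s - m s\<bar> < \<delta>"
    using s by (intro AE_PiM_component[where P = "\<lambda>x. \<bar>x - m s\<bar> < \<delta>"]
        prob_space_uniform_interval assms)
qed

text \<open>A null set \<open>N\<close> of the second factor lifts to
  \<open>space M1 \<times> N\<close>, whose measure is zero even if \<open>M1\<close> has infinite
  mass.\<close>

lemma AE_pair_snd:
  assumes "sigma_finite_measure M2" and "AE y in M2. P y"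
  shows "AE z in M1 \<Otimes>\<^sub>M M2. P (snd z)"
proof -
  interpret sigma_finite_measure M2 by fact
  obtain N where N: "{y \<in> space M2. \<not> P y} \<subseteq> N" "emeasure M2 N = 0" "N \<in> sets M2"
    using assms(2) by (rule AE_E)
  show ?thesis
  proof (rule AE_I)
    show "{z \<in> space (M1 \<Otimes>\<^sub>M M2). \<not> P (snd z)} \<subseteq> space M1 \<times> N"
      using N(1) by (auto simp: space_pair_measure)
    show "emeasure (M1 \<Otimes>\<^sub>M M2) (space M1 \<times> N) = 0"
      using N by (subst emeasure_pair_measure_Times) auto
  qed (use N in auto)
qed

text \<open>The normalising constant of the Dirichlet density enters the numerator and the denominator of
  the posterior through the same factor \<open>dirichlet_mode\<close> and cancels.\<close>

lemma posterior_le: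
  assumes "S \<ge> 1" and "c \<ge> 2" and "0 < r" and "r \<le> \<delta>" and \<theta>': "\<theta>' \<in> param_space S"
    and "0 \<le> Q" and "0 < q"
    and upper: "\<And>\<theta>. \<theta> \<in> A \<Longrightarrow> (\<And>s. s < S \<Longrightarrow> \<bar>snd \<theta> s - snd \<theta>' s\<bar> < \<delta>) \<Longrightarrow> likelihood \<sigma> S n X \<theta> \<le> Q"
    and lower: "\<And>\<theta>. \<theta> \<in> param_space S \<Longrightarrow> (\<And>s. s < S \<Longrightarrow> (1 - 1 / c) * fst \<theta>' s \<le> fst \<theta> s) \<Longrightarrow>
        (\<And>s. s < S \<Longrightarrow> \<bar>snd \<theta> s - snd \<theta>' s\<bar> < r) \<Longrightarrow> q \<le> likelihood \<sigma> S n X \<theta>"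
  shows "posterior \<sigma> S n X (empirical_prior S c \<delta> \<theta>') A
    \<le> ennreal (Q / q * exp 2 * (c * real S) ^ (S - 1) * (\<delta> / r) ^ S)"
proof -
  let ?L = "\<lambda>\<theta>. ennreal (likelihood \<sigma> S n X \<theta>)"
  let ?M1 = "dirichlet S (\<lambda>s. 1 + c * fst \<theta>' s)"
  let ?M2 = "PiM {..<S} (\<lambda>s. uniform_measure lborel {snd \<theta>' s - \<delta><..<snd \<theta>' s + \<delta>})"
  let ?\<nu> = "?M1 \<Otimes>\<^sub>M ?M2"
  let ?m = "dirichlet_mode S c (fst \<theta>')"
  let ?Bw = "weight_neighbourhood S c (fst \<theta>')"
  let ?Bl = "\<Pi>\<^sub>E s\<in>{..<S}. {snd \<theta>' s - r<..<snd \<theta>' s + r}"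
  let ?d = "?m * exp (- 2) * (1 / (c * real S)) ^ (S - 1)"
  have \<delta>: "\<delta> > 0" using assms(3,4) by simp
  have w': "fst \<theta>' \<in> prob_simplex S" using \<theta>' by (simp add: param_space_def mem_Times_iff)
  have mode: "0 < ?m"
    using dirichlet_mode_pos[OF assms(1), of c "fst \<theta>'"] assms(2) param_space_nonneg[OF \<theta>'] by simp
  interpret M2: prob_space ?M2
    by (intro prob_space_PiM prob_space_uniform_interval \<delta>)
  have sig: "sigma_finite_measure ?M2" ..
  have "(\<integral>\<^sup>+\<theta>\<in>A. ?L \<theta> \<partial>?\<nu>) \<le> (\<integral>\<^sup>+\<theta>. ennreal Q \<partial>?\<nu>)"
  proof (rule nn_integral_mono_AE)
    \<comment> \<open>\<open>upper\<close> speaks only of locations within \<delta> of the estimate,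
      which hold almost everywhere under the prior.\<close>
    show "AE \<theta> in ?\<nu>. ?L \<theta> * indicator A \<theta> \<le> ennreal Q"
      using AE_pair_snd[OF sig AE_uniform_box[OF \<delta>], where ?M1.0 = ?M1]
    proof eventually_elim
      case (elim \<theta>)
      then show ?case using upper[of \<theta>] by (auto split: split_indicator intro: ennreal_leI)
    qed
  qed
  also have "\<dots> = ennreal Q * emeasure ?\<nu> (space ?M1 \<times> space ?M2)"
    by (simp add: space_pair_measure)
  also have "\<dots> = ennreal Q * emeasure ?M1 (space ?M1)"
    by (subst M2.emeasure_pair_measure_Times[OF sets.top sets.top]) (simp add: M2.emeasure_space_1)
  also have "\<dots> \<le> ennreal Q * ennreal ?m"
    using emeasure_dirichlet_le_mode[OF assms(1) _ w', of c] assms(2) by (intro mult_left_mono) auto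
  also have "\<dots> = ennreal (Q * ?m)" using assms(6) by (simp add: ennreal_mult')
  finally have num: "(\<integral>\<^sup>+\<theta>\<in>A. ?L \<theta> \<partial>?\<nu>) \<le> ennreal (Q * ?m)" .
  have sub: "\<theta> \<in> param_space S \<and> q \<le> likelihood \<sigma> S n X \<theta>" if "\<theta> \<in> ?Bw \<times> ?Bl" for \<theta>
  proof -
    have fst: "fst \<theta> \<in> ?Bw" and snd: "snd \<theta> \<in> ?Bl"
      using that by (simp_all only: mem_Times_iff)
    have "\<theta> \<in> param_space S"
      using fst snd
      by (simp add: param_space_def mem_Times_iff prob_simplex_def weight_neighbourhood_def
          space_PiM PiE_iff less_imp_le)
    moreover have "\<bar>snd \<theta> s - snd \<theta>' s\<bar> < r" if "s < S" for s
    proof -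
      have "snd \<theta> s \<in> {snd \<theta>' s - r<..<snd \<theta>' s + r}"
        using snd that by (intro PiE_mem[OF snd]) auto
      then show ?thesis by (auto simp: abs_less_iff)
    qed
    moreover have "(1 - 1 / c) * fst \<theta>' s \<le> fst \<theta> s" if "s < S" for s
      using fst that by (auto simp: weight_neighbourhood_def)
    ultimately show ?thesis using lower by blast
  qed
  \<comment> \<open>The denominator is bounded below by \<open>q\<close> times the prior mass of the
    product of the weight neighbourhood and the location box.\<close>
  have "ennreal (q * (?d * (r / \<delta>) ^ S)) = ennreal q * (ennreal ?d * ennreal ((r / \<delta>) ^ S))"
    using assms(2,3,7) \<delta> mode by (simp add: ennreal_mult)
  also have "\<dots> \<le> ennreal q * (emeasure ?M1 ?Bw * emeasure ?M2 ?Bl)"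
    using emeasure_dirichlet_ge_mode[OF assms(1,2) w'] emeasure_uniform_box[OF assms(3,4), of S "snd \<theta>'"]
    by (intro mult_left_mono mult_mono) auto
  also have "\<dots> = ennreal q * emeasure ?\<nu> (?Bw \<times> ?Bl)"
    by (subst M2.emeasure_pair_measure_Times) (auto intro!: sets_PiM_I_finite)
  also have "\<dots> = (\<integral>\<^sup>+\<theta>. ennreal q * indicator (?Bw \<times> ?Bl) \<theta> \<partial>?\<nu>)"
    by (rule nn_integral_cmult_indicator[symmetric])
       (auto intro!: sets_PiM_I_finite pair_measureI)
  also have "\<dots> \<le> (\<integral>\<^sup>+\<theta>\<in>param_space S. ?L \<theta> \<partial>?\<nu>)"
    using sub by (intro nn_integral_mono) (auto split: split_indicator intro: ennreal_leI)
  finally have den: "ennreal (q * (?d * (r / \<delta>) ^ S)) \<le> (\<integral>\<^sup>+\<theta>\<in>param_space S. ?L \<theta> \<partial>?\<nu>)" .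
  have dpos: "0 < q * (?d * (r / \<delta>) ^ S)"
    using assms(1,2,3,7) \<delta> mode by (intro mult_pos_pos zero_less_power) auto
  have "posterior \<sigma> S n X (empirical_prior S c \<delta> \<theta>') A
      \<le> ennreal (Q * ?m / (q * (?d * (r / \<delta>) ^ S)))"
    unfolding posterior_def empirical_prior_def
    using num den _ dpos by (rule divide_le_ennreal) (use assms(6) mode in simp)
  also have "Q * ?m / (q * (?d * (r / \<delta>) ^ S)) = Q / q * exp 2 * (c * real S) ^ (S - 1) * (\<delta> / r) ^ S"
    using mode assms(1,2,3,7) \<delta> by (simp add: exp_minus power_divide field_simps)
  finally show ?thesis .
qed

section \<open>Hellinger affinity and the parameter grid\<close>

text \<open>Splitting \<open>u = q + (u - q)\<close> under the root separates the affinity of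
  \<open>q\<close> and \<open>p\<close>, which is 1 - H^2, from an error due to the excess mass
  \<open>I - 1\<close>. The free parameter \<open>l\<close> balances the two terms of that
  error.\<close>

lemma affinity_le_hellinger:
  fixes p q u :: "real \<Rightarrow> real"
  assumes p: "has_bochner_integral lborel p 1" and q: "has_bochner_integral lborel q 1"
    and u: "has_bochner_integral lborel u I"
    and nonneg: "\<And>x. 0 \<le> p x" "\<And>x. 0 \<le> q x" and le: "\<And>x. q x \<le> u x" and "l > 0"
  shows "(\<integral>\<^sup>+x. ennreal (sqrt (u x * p x)) \<partial>lborel)
    \<le> ennreal (1 - (hellinger p q)\<^sup>2 + (l * (I - 1) + 1 / l) / 2)"
proof -
  define D where "D = (\<lambda>x. (sqrt (p x) - sqrt (q x))\<^sup>2)"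
  define F where "F = (\<lambda>x. (p x + q x) / 2 - 1 / 2 * D x + (l * (u x - q x) + 1 / l * p x) / 2)"
  have [measurable]: "p \<in> borel_measurable lborel" "q \<in> borel_measurable lborel"
    using p q by (auto dest: borel_measurable_has_bochner_integral)
  have "D x = p x + q x - 2 * (sqrt (p x) * sqrt (q x))" for x
    using nonneg by (simp add: D_def power2_diff)
  then have D_le: "D x \<le> p x + q x" for x
    using nonneg by simp
  have D: "integrable lborel D"
  proof (rule Bochner_Integration.integrable_bound)
    show "integrable lborel (\<lambda>x. p x + q x)"
      using p q by (auto simp: has_bochner_integral_iff)
    show "D \<in> borel_measurable lborel" unfolding D_def by measurable
    show "AE x in lborel. norm (D x) \<le> norm (p x + q x)"
      using D_le nonneg by (auto simp: D_def add_nonneg_nonneg)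
  qed
  have hell: "(hellinger p q)\<^sup>2 = 1 / 2 * integral\<^sup>L lborel D"
    unfolding hellinger_def D_def by (subst real_sqrt_pow2) (auto intro: integral_nonneg_AE)
  have "has_bochner_integral lborel F
      ((1 + 1) / 2 - 1 / 2 * integral\<^sup>L lborel D + (l * (I - 1) + 1 / l * 1) / 2)"
    unfolding F_def
    by (intro has_bochner_integral_add has_bochner_integral_diff has_bochner_integral_divide_zero
        has_bochner_integral_mult_right p q u has_bochner_integral_integrable D)
  then have F: "has_bochner_integral lborel F (1 - (hellinger p q)\<^sup>2 + (l * (I - 1) + 1 / l) / 2)"
    by (simp add: hell)
  have le_F: "sqrt (u x * p x) \<le> F x" for x
  proof -
    have "sqrt (u x * p x) = sqrt (q x * p x + (u x - q x) * p x)"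
      by (simp add: algebra_simps)
    also have "\<dots> \<le> sqrt (q x * p x) + sqrt ((u x - q x) * p x)"
      using nonneg le by (intro sqrt_add_le_add_sqrt) auto
    also have "sqrt (q x * p x) = (p x + q x) / 2 - 1 / 2 * D x"
      using nonneg by (simp add: D_def power2_diff real_sqrt_mult field_simps)
    \<comment> \<open>Inserting \<open>l\<close> and \<open>1 / l\<close> before the
      arithmetic-geometric mean inequality gives the small function \<open>u - q\<close> the large
      weight.\<close>
    also have "sqrt ((u x - q x) * p x) = sqrt ((l * (u x - q x)) * (1 / l * p x))"
      using \<open>l > 0\<close> by simp
    also have "\<dots> \<le> (l * (u x - q x) + 1 / l * p x) / 2"
      using nonneg le \<open>l > 0\<close> by (intro arith_geo_mean_sqrt) auto
    finally show ?thesis by (simp add: F_def)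
  qed
  have "0 \<le> u x * p x" for x
    using nonneg[of x] le[of x] by (intro mult_nonneg_nonneg) linarith+
  then have F0: "0 \<le> F x" for x
    using le_F[of x] real_sqrt_ge_zero by (meson order_trans)
  have "(\<integral>\<^sup>+x. ennreal (sqrt (u x * p x)) \<partial>lborel) \<le> (\<integral>\<^sup>+x. ennreal (F x) \<partial>lborel)"
    using le_F by (intro nn_integral_mono ennreal_leI) auto
  also have "\<dots> = ennreal (1 - (hellinger p q)\<^sup>2 + (l * (I - 1) + 1 / l) / 2)"
    using F F0 by (subst nn_integral_eq_integral) (auto simp: has_bochner_integral_iff)
  finally show ?thesis .
qed

text \<open>Independence factorises the integral, and p sqrt (u / p) = sqrt (u p) turns each factor
  into the affinity.\<close>

lemma nn_integral_prod_sqrt_ratio: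
  fixes p u :: "real \<Rightarrow> real"
  assumes [measurable]: "p \<in> borel_measurable borel" "u \<in> borel_measurable borel"
    and "has_bochner_integral lborel p 1" and pos: "\<And>x. 0 < p x"
  shows "(\<integral>\<^sup>+X. (\<Prod>i<n. ennreal (sqrt (u (X i) / p (X i)))) \<partial>sample_measure p n)
    = (\<integral>\<^sup>+x. ennreal (sqrt (u x * p x)) \<partial>lborel) ^ n"
proof -
  let ?D = "density lborel (\<lambda>x. ennreal (p x))"
  have "(\<integral>\<^sup>+x. ennreal (p x) \<partial>lborel) = 1"
    using assms(3) pos by (subst nn_integral_eq_integral) (auto simp: has_bochner_integral_iff less_imp_le)
  then interpret D: prob_space ?D
    by (intro prob_spaceI) (simp add: emeasure_density)
  interpret product_sigma_finite "\<lambda>_::nat. ?D" ..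
  have "(\<integral>\<^sup>+x. ennreal (sqrt (u x / p x)) \<partial>?D)
      = (\<integral>\<^sup>+x. ennreal (p x) * ennreal (sqrt (u x / p x)) \<partial>lborel)"
    by (subst nn_integral_density) auto
  also have "\<dots> = (\<integral>\<^sup>+x. ennreal (sqrt (u x * p x)) \<partial>lborel)"
  proof (rule nn_integral_cong)
    fix x
    have "p x * sqrt (u x / p x) = sqrt ((p x)\<^sup>2) * sqrt (u x / p x)"
      using pos[of x] by simp
    also have "\<dots> = sqrt ((p x)\<^sup>2 * (u x / p x))"
      by (rule real_sqrt_mult[symmetric])
    also have "(p x)\<^sup>2 * (u x / p x) = u x * p x"
      using pos[of x] by (simp add: power2_eq_square)
    finally show "ennreal (p x) * ennreal (sqrt (u x / p x)) = ennreal (sqrt (u x * p x))"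
      using pos[of x] by (simp add: ennreal_mult'[symmetric] less_imp_le)
  qed
  finally show ?thesis
    unfolding sample_measure_def by (subst product_nn_integral_prod) auto
qed

section \<open>The grid of bracketing parameters\<close>

definition grid :: "nat \<Rightarrow> nat \<Rightarrow> nat \<Rightarrow> param set" where
  "grid m L S =
     ({..<S} \<rightarrow>\<^sub>E (\<lambda>i. (real i + 1) / real m) ` {..m})
     \<times> ({..<S} \<rightarrow>\<^sub>E (\<lambda>i. real_of_int i / real m) ` {- int L..int L})"

text \<open>Weights are rounded up, so the grid point dominates \<theta> weight by weight and, after
  the kernel shift factor, gives an upper bracket. The price is a total weight of up to 1 + S /
  m.\<close>

definition near_grid :: "nat \<Rightarrow> nat \<Rightarrow> param \<Rightarrow> param \<Rightarrow> bool" where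
  "near_grid m S g \<theta> \<longleftrightarrow> (\<forall>s<S. fst \<theta> s \<le> fst g s \<and> fst g s \<le> fst \<theta> s + 1 / real m
     \<and> \<bar>snd g s - snd \<theta> s\<bar> \<le> 1 / real m)"

lemma finite_grid: "finite (grid m L S)"
  unfolding grid_def by (intro finite_cartesian_product finite_PiE) auto

lemma card_grid_le: "card (grid m L S) \<le> ((m + 1) * (2 * L + 1)) ^ S"
proof -
  have "card ((\<lambda>i. (real i + 1) / real m) ` {..m}) \<le> m + 1"
    using card_image_le[of "{..m}"] by simp
  moreover have "card ((\<lambda>i. real_of_int i / real m) ` {- int L..int L}) \<le> 2 * L + 1"
    using card_image_le[of "{- int L..int L}" "\<lambda>i. real_of_int i / real m"] by simp
  ultimately show ?thesis
    unfolding grid_def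
    by (simp add: card_cartesian_product card_PiE power_mult_distrib mult_mono power_mono
        del: add_Suc_right)
qed

text \<open>Take floors of the rescaled coordinates. The \<open>+ 1\<close> in the weight grid turns
  a floor into rounding up, and weights at most 1 keep the index in \<open>{..m}\<close>;
  \<open>L\<close> bounds the location indices.\<close>

lemma near_grid_exists:
  assumes "m \<ge> 1" and \<theta>: "\<theta> \<in> param_space S" and b: "\<And>s. s < S \<Longrightarrow> \<bar>snd \<theta> s\<bar> \<le> b"
    and L: "real m * b + 1 \<le> real L"
  shows "\<exists>g\<in>grid m L S. near_grid m S g \<theta>"
proof -
  have m: "0 < real m" using assms(1) by simp
  define w where "w = (\<lambda>s\<in>{..<S}. (real (nat \<lfloor>fst \<theta> s * real m\<rfloor>) + 1) / real m)"
  define h where "h = (\<lambda>s\<in>{..<S}. real_of_int \<lfloor>snd \<theta> s * real m\<rfloor> / real m)"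
  have w_mem: "\<lfloor>fst \<theta> s * real m\<rfloor> \<ge> 0" "nat \<lfloor>fst \<theta> s * real m\<rfloor> \<le> m" if "s < S" for s
  proof -
    have nn: "0 \<le> fst \<theta> s" using param_space_nonneg[OF \<theta> that] .
    have "fst \<theta> s \<le> (\<Sum>s<S. fst \<theta> s)"
      using param_space_nonneg[OF \<theta>] that by (intro member_le_sum) auto
    then have "fst \<theta> s \<le> 1" using param_space_sum[OF \<theta>] by simp
    then have "fst \<theta> s * real m \<le> real m" using m by simp
    then have "\<lfloor>fst \<theta> s * real m\<rfloor> \<le> int m" by (simp add: floor_le_iff)
    then show "nat \<lfloor>fst \<theta> s * real m\<rfloor> \<le> m" by simp
    show "\<lfloor>fst \<theta> s * real m\<rfloor> \<ge> 0" using nn by simp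
  qed
  have h_mem: "\<lfloor>snd \<theta> s * real m\<rfloor> \<in> {- int L..int L}" if "s < S" for s
  proof -
    have "\<bar>snd \<theta> s\<bar> * real m \<le> b * real m" using b[OF that] m by simp
    then have "\<bar>snd \<theta> s * real m\<bar> \<le> real L - 1" using L by (simp add: abs_mult mult.commute)
    then show ?thesis by (simp add: le_floor_iff floor_le_iff abs_le_iff)
  qed
  have "(w, h) \<in> grid m L S"
    unfolding grid_def w_def h_def using w_mem(2) h_mem
    by (auto simp: PiE_iff simp del: of_nat_nat intro!: imageI)
  moreover have "near_grid m S (w, h) \<theta>"
    unfolding near_grid_def
  proof (intro allI impI)
    fix s assume s: "s < S"
    define f where "f = real_of_int \<lfloor>fst \<theta> s * real m\<rfloor>"
    define k where "k = real_of_int \<lfloor>snd \<theta> s * real m\<rfloor>"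
    have ws: "w s = (f + 1) / real m"
      using s w_mem(1)[OF s] by (simp add: w_def f_def of_nat_nat)
    have hs: "h s = k / real m" using s by (simp add: h_def k_def)
    have f: "f \<le> fst \<theta> s * real m" "fst \<theta> s * real m \<le> f + 1"
      unfolding f_def by linarith+
    have k: "k \<le> snd \<theta> s * real m" "snd \<theta> s * real m \<le> k + 1"
      unfolding k_def by linarith+
    show "fst \<theta> s \<le> fst (w, h) s \<and> fst (w, h) s \<le> fst \<theta> s + 1 / real m
        \<and> \<bar>snd (w, h) s - snd \<theta> s\<bar> \<le> 1 / real m"
    proof -
      have "f / real m \<le> fst \<theta> s" "fst \<theta> s \<le> (f + 1) / real m"
        using f m by (simp_all add: pos_divide_le_eq pos_le_divide_eq)
      moreover have "k / real m \<le> snd \<theta> s" "snd \<theta> s \<le> (k + 1) / real m"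
        using k m by (simp_all add: pos_divide_le_eq pos_le_divide_eq)
      ultimately show ?thesis by (simp add: ws hs add_divide_distrib abs_le_iff)
    qed
  qed
  ultimately show ?thesis by blast
qed

section \<open>The expected posterior at a fixed sample size\<close>

lemma likelihood_pos:
  assumes "\<sigma> > 0" and "\<theta> \<in> param_space S"
  shows "0 < likelihood \<sigma> S n X \<theta>"
  unfolding likelihood_def using mixture_pos[OF assms] by (intro prod_pos) auto

text \<open>The true mixture, padded with components of weight zero, competes in the maximisation.\<close>

lemma likelihood_mle_ge:
  assumes mle: "is_mle \<sigma> S B n X \<theta>'" and \<theta>: "\<theta> \<in> param_space K" and "K \<le> S" and "0 \<le> B"
    and B: "\<And>s. s < K \<Longrightarrow> \<bar>snd \<theta> s\<bar> \<le> B"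
  shows "likelihood \<sigma> K n X \<theta> \<le> likelihood \<sigma> S n X \<theta>'"
proof -
  define w where "w = (\<lambda>s\<in>{..<S}. if s < K then fst \<theta> s else 0)"
  \<comment> \<open>The padding location 0 respects the restriction on the locations because
    \<open>0 \<le> B\<close>.\<close>
  define h where "h = (\<lambda>s\<in>{..<S}. if s < K then snd \<theta> s else 0)"
  have pad: "(\<Sum>s<S. if s < K then f s else 0) = (\<Sum>s<K. f s)" for f :: "nat \<Rightarrow> real"
    using \<open>K \<le> S\<close> by (intro sum.mono_neutral_cong_right) auto
  have "(\<Sum>s<S. w s) = (\<Sum>s<S. if s < K then fst \<theta> s else 0)"
    by (intro sum.cong) (auto simp: w_def)
  then have "(\<Sum>s<S. w s) = 1" using param_space_sum[OF \<theta>] pad by simp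
  then have mem: "(w, h) \<in> param_space S" "\<forall>s<S. \<bar>h s\<bar> \<le> B"
    using param_space_nonneg[OF \<theta>] B \<open>0 \<le> B\<close>
    by (simp_all add: param_space_def prob_simplex_def w_def h_def)
  have "mixture \<sigma> S (w, h) x = mixture \<sigma> K \<theta> x" for x
    unfolding mixture_def pad[symmetric] by (intro sum.cong) (auto simp: w_def h_def)
  then have "likelihood \<sigma> K n X \<theta> = likelihood \<sigma> S n X (w, h)"
    by (simp add: likelihood_def)
  also have "\<dots> \<le> likelihood \<sigma> S n X \<theta>'"
    using mle mem unfolding is_mle_def is_arg_max_def by (metis not_less snd_conv)
  finally show ?thesis .
qed

text \<open>Each observation loses at most the factor (1 - 1 / c) exp (- 2 / (n \<sigma>)). Over
  \<open>n\<close> observations the first part costs at most \<open>exp (- 2)\<close>, as n \<le> c,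
  and the second exactly exp (- 2 / \<sigma>).\<close>

lemma likelihood_ge_mle:
  assumes "\<sigma> > 0" and "c \<ge> 2" and "1 \<le> n" and "real n \<le> c"
    and \<theta>': "\<theta>' \<in> param_space S" and \<theta>: "\<theta> \<in> param_space S"
    and w: "\<And>s. s < S \<Longrightarrow> (1 - 1 / c) * fst \<theta>' s \<le> fst \<theta> s"
    and h: "\<And>s. s < S \<Longrightarrow> \<bar>snd \<theta> s - snd \<theta>' s\<bar> < 1 / real n"
  shows "likelihood \<sigma> S n X \<theta>' * exp (- (2 + 2 / \<sigma>)) \<le> likelihood \<sigma> S n X \<theta>"
proof -
  define a where "a = 1 - 1 / c"
  define e where "e = 2 * (1 / real n) / \<sigma>"
  have a: "0 < a" using assms(2) by (simp add: a_def)
  have *: "mixture \<sigma> S \<theta>' x * (a * exp (- e)) \<le> mixture \<sigma> S \<theta> x" for x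
  proof -
    have "mixture \<sigma> S \<theta>' x \<le> 1 / a * exp e * mixture \<sigma> S \<theta> x"
      unfolding e_def
    proof (rule mixture_le_mixture[OF assms(1)])
      fix s assume s: "s < S"
      show "0 \<le> fst \<theta>' s \<and> fst \<theta>' s \<le> 1 / a * fst \<theta> s"
        using w[OF s] a param_space_nonneg[OF \<theta>' s] by (simp add: a_def[symmetric] field_simps)
      show "\<bar>snd \<theta> s - snd \<theta>' s\<bar> \<le> 1 / real n" using h[OF s] by simp
    qed (use a in simp)
    then show ?thesis using a by (simp add: exp_minus field_simps)
  qed
  have "likelihood \<sigma> S n X \<theta>' * (a * exp (- e)) ^ n \<le> likelihood \<sigma> S n X \<theta>"
  proof -
    have "likelihood \<sigma> S n X \<theta>' * (a * exp (- e)) ^ n = (\<Prod>i<n. mixture \<sigma> S \<theta>' (X i) * (a * exp (- e)))"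
      by (simp add: likelihood_def prod.distrib)
    also have "\<dots> \<le> likelihood \<sigma> S n X \<theta>"
      unfolding likelihood_def using mixture_pos[OF assms(1) \<theta>'] a *
      by (intro prod_mono) (simp add: less_imp_le)
    finally show ?thesis .
  qed
  moreover have "exp (- (2 + 2 / \<sigma>)) \<le> (a * exp (- e)) ^ n"
  proof -
    have "- 2 \<le> - 2 * (real n / c)"
      using assms(2,4) by (simp add: divide_le_eq)
    also have "\<dots> = real n * (- 2 / c)" by simp
    also have "\<dots> \<le> real n * ln a"
      unfolding a_def by (intro mult_left_mono ln_one_minus_inverse_ge assms(2)) simp
    finally have "exp (- 2 - 2 / \<sigma>) \<le> exp (real n * ln a - real n * e)"
      using assms(1,3) by (simp add: e_def)
    also have "\<dots> = (a * exp (- e)) ^ n"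
      using a by (simp add: exp_diff exp_of_nat_mult exp_of_nat2_mult exp_minus power_mult_distrib power_inverse field_simps)
    finally show ?thesis by simp
  qed
  then have "likelihood \<sigma> S n X \<theta>' * exp (- (2 + 2 / \<sigma>)) \<le> likelihood \<sigma> S n X \<theta>' * (a * exp (- e)) ^ n"
    using likelihood_pos[OF assms(1) \<theta>'] by (intro mult_left_mono) (auto intro: less_imp_le)
  ultimately show ?thesis by linarith
qed

text \<open>A number bounded by 1 and by z is at most sqrt z; here z = k y^2.\<close>

lemma le_ennreal_sqrt_mult:
  assumes "P \<le> 1" and "P \<le> ennreal (k * y\<^sup>2)" and "0 \<le> k" and "0 \<le> y"
  shows "P \<le> ennreal (sqrt k * y)"
proof (cases "sqrt k * y \<le> 1")
  case True
  have "k * y\<^sup>2 = (sqrt k * y) * (sqrt k * y)"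
    using assms(3) by (simp add: power2_eq_square mult_ac)
  also have "\<dots> \<le> sqrt k * y"
    using True assms(3,4) by (simp add: mult_left_le)
  finally show ?thesis using assms(2) ennreal_leI order_trans by blast
next
  case False
  then have "ennreal 1 \<le> ennreal (sqrt k * y)" by (intro ennreal_leI) simp
  then show ?thesis using assms(1) by (metis ennreal_1 order_trans)
qed

text \<open>Here \<open>m\<close> and \<open>L\<close> fix the resolution and extent of the grid and
  \<open>t\<close> is the radius. The condition \<open>err\<close> lets the bracketing error consume
  only half of the Hellinger gain t^2, leaving t^2 / 2 per observation.\<close>

lemma expected_posterior_le:
  assumes "\<sigma> > 0" and \<theta>s: "\<theta>s \<in> param_space K" and "K \<le> S" and "S \<ge> 1" and "0 \<le> B"
    and B: "\<And>s. s < K \<Longrightarrow> \<bar>snd \<theta>s s\<bar> \<le> B"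
    and "c \<ge> 2" and "1 \<le> n" and "real n \<le> c" and \<delta>: "1 / real n \<le> \<delta>"
    and "1 \<le> m" and L: "real m * (B + \<delta>) + 1 \<le> real L"
    and mle: "mle_estimator \<sigma> S B (mixture \<sigma> K \<theta>s) n \<theta>hat"
    and "0 \<le> t" and "0 < l" and err: "l * (exp (2 / (real m * \<sigma>)) * (1 + real S / real m) - 1) + 1 / l \<le> t\<^sup>2"
  shows "(\<integral>\<^sup>+X. posterior \<sigma> S n X (empirical_prior S c \<delta> (\<theta>hat X))
        {\<theta> \<in> param_space S. hellinger (mixture \<sigma> K \<theta>s) (mixture \<sigma> S \<theta>) > t}
      \<partial>sample_measure (mixture \<sigma> K \<theta>s) n)
    \<le> ennreal (sqrt (exp (4 + 2 / \<sigma>) * (c * real S) ^ (S - 1) * (real n * \<delta>) ^ S)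
        * real (card (grid m L S)) * exp (- (real n * t\<^sup>2 / 2)))"
proof -
  define p where "p = mixture \<sigma> K \<theta>s"
  define u where "u = (\<lambda>g x. exp (2 * (1 / real m) / \<sigma>) * mixture \<sigma> S g x)"
  define A where "A = {\<theta> \<in> param_space S. hellinger p (mixture \<sigma> S \<theta>) > t}"
  \<comment> \<open>Only cells meeting \<open>A\<close> are kept; each of them has a witness at
    distance more than \<open>t\<close>, which the affinity bound uses.\<close>
  define G where "G = {g \<in> grid m L S. \<exists>\<theta>\<in>A. near_grid m S g \<theta>}"
  define y where "y = (\<lambda>g X. \<Prod>i<n. sqrt (u g (X i) / p (X i)))"
  \<comment> \<open>Collects \<open>exp (2 + 2 / \<sigma>)\<close> from the likelihood near the
    estimate, \<open>exp 2\<close> from the Dirichlet density, and the inverse volumes of the weight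
    and location boxes.\<close>
  define k where "k = exp (4 + 2 / \<sigma>) * (c * real S) ^ (S - 1) * (real n * \<delta>) ^ S"
  have \<delta>0: "0 < \<delta>" using \<delta> assms(8) by (intro less_le_trans[OF _ \<delta>]) simp
  have k0: "0 \<le> k" using assms(7) \<delta>0 by (simp add: k_def)
  have finG: "finite G" unfolding G_def using finite_grid by simp
  have p_pos: "0 < p x" for x unfolding p_def by (rule mixture_pos[OF assms(1) \<theta>s])
  have p_int: "has_bochner_integral lborel p 1"
    using has_bochner_integral_mixture[OF assms(1), of K \<theta>s] param_space_sum[OF \<theta>s]
    by (simp add: p_def)
  have [measurable]: "p \<in> borel_measurable borel" "u g \<in> borel_measurable borel" for g
    unfolding p_def u_def by measurable
  have le_u: "mixture \<sigma> S \<theta> x \<le> u g x" if "\<theta> \<in> param_space S" "near_grid m S g \<theta>" for \<theta> g x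
    using mixture_le_mixture[OF assms(1), of 1 S \<theta> g "1 / real m" x] that param_space_nonneg
    by (simp add: near_grid_def u_def)
  have u_nonneg: "0 \<le> u g x" if "g \<in> G" for g x
    using that le_u mixture_pos[OF assms(1)] unfolding G_def A_def
    by (smt (verit, best) mem_Collect_eq)
  have ratio_nonneg: "0 \<le> u g x / p x" if "g \<in> G" for g x
    using u_nonneg[OF that] p_pos by (intro divide_nonneg_pos)
  have y_nonneg: "0 \<le> y g X" if "g \<in> G" for g X
    unfolding y_def using ratio_nonneg[OF that] by (intro prod_nonneg) simp
  have pointwise: "posterior \<sigma> S n X (empirical_prior S c \<delta> (\<theta>hat X)) A
      \<le> ennreal (sqrt k) * (\<Sum>g\<in>G. \<Prod>i<n. ennreal (sqrt (u g (X i) / p (X i))))"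
    if X: "X \<in> space (sample_measure p n)" for X
  proof -
    \<comment> \<open>The sum over \<open>G\<close> dominates the maximum and allows the expectation
      to be taken term by term.\<close>
    define Y where "Y = (\<Sum>g\<in>G. y g X)"
    have Y: "0 \<le> Y" unfolding Y_def using y_nonneg by (intro sum_nonneg) auto
    have ismle: "is_mle \<sigma> S B n X (\<theta>hat X)"
      using mle X by (simp add: mle_estimator_def p_def)
    then have \<theta>h: "\<theta>hat X \<in> param_space S" and hB: "\<And>s. s < S \<Longrightarrow> \<bar>snd (\<theta>hat X) s\<bar> \<le> B"
      by (simp_all add: is_mle_def is_arg_max_def)
    let ?Lh = "likelihood \<sigma> S n X (\<theta>hat X)"
    have Lh: "0 < ?Lh" using likelihood_pos[OF assms(1) \<theta>h] .
    have "posterior \<sigma> S n X (empirical_prior S c \<delta> (\<theta>hat X)) A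
      \<le> ennreal (?Lh * Y\<^sup>2 / (?Lh * exp (- (2 + 2 / \<sigma>))) * exp 2 * (c * real S) ^ (S - 1) * (\<delta> / (1 / real n)) ^ S)"
    proof (rule posterior_le[OF assms(4,7) _ \<delta> \<theta>h])
      fix \<theta> assume \<theta>: "\<theta> \<in> A" and near: "\<And>s. s < S \<Longrightarrow> \<bar>snd \<theta> s - snd (\<theta>hat X) s\<bar> < \<delta>"
      have \<theta>S: "\<theta> \<in> param_space S" using \<theta> by (simp add: A_def)
      have "\<bar>snd \<theta> s\<bar> \<le> B + \<delta>" if "s < S" for s
        using near[OF that] hB[OF that] by linarith
      then obtain g where g: "g \<in> grid m L S" "near_grid m S g \<theta>"
        using near_grid_exists[OF assms(11) \<theta>S _ L] by blast
      then have gG: "g \<in> G" using \<theta> by (auto simp: G_def)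
      have "likelihood \<sigma> S n X \<theta> \<le> (\<Prod>i<n. u g (X i))"
        unfolding likelihood_def using mixture_pos[OF assms(1) \<theta>S] le_u[OF \<theta>S g(2)]
        by (intro prod_mono) (auto intro: less_imp_le)
      also have "\<dots> = (\<Prod>i<n. p (X i)) * (\<Prod>i<n. u g (X i) / p (X i))"
        unfolding prod.distrib[symmetric] using p_pos
        by (intro prod.cong) (auto simp: less_imp_neq[THEN not_sym])
      also have "(\<Prod>i<n. u g (X i) / p (X i)) = (y g X)\<^sup>2"
        unfolding y_def prod_power_distrib using ratio_nonneg[OF gG]
        by (intro prod.cong) simp_all
      also have "(\<Prod>i<n. p (X i)) = likelihood \<sigma> K n X \<theta>s"
        by (simp add: likelihood_def p_def)
      \<comment> \<open>Passing from the truth to the estimate produces the factor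
        \<open>?Lh\<close>, which then cancels against the same factor in the denominator.\<close>
      also have "likelihood \<sigma> K n X \<theta>s * (y g X)\<^sup>2 \<le> ?Lh * Y\<^sup>2"
      proof (intro mult_mono power_mono)
        show "likelihood \<sigma> K n X \<theta>s \<le> ?Lh"
          by (rule likelihood_mle_ge[OF ismle \<theta>s assms(3,5) B])
        show "y g X \<le> Y"
          unfolding Y_def using finG gG y_nonneg by (intro member_le_sum) auto
      qed (use Lh y_nonneg[OF gG] in auto)
      finally show "likelihood \<sigma> S n X \<theta> \<le> ?Lh * Y\<^sup>2" .
    next
      fix \<theta> assume "\<theta> \<in> param_space S" "\<And>s. s < S \<Longrightarrow> (1 - 1 / c) * fst (\<theta>hat X) s \<le> fst \<theta> s"
        "\<And>s. s < S \<Longrightarrow> \<bar>snd \<theta> s - snd (\<theta>hat X) s\<bar> < 1 / real n"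
      then show "?Lh * exp (- (2 + 2 / \<sigma>)) \<le> likelihood \<sigma> S n X \<theta>"
        by (intro likelihood_ge_mle[OF assms(1,7,8,9) \<theta>h])
    qed (use assms(8) Lh in auto)
    also have "?Lh * Y\<^sup>2 / (?Lh * exp (- (2 + 2 / \<sigma>))) * exp 2 * (c * real S) ^ (S - 1) * (\<delta> / (1 / real n)) ^ S
        = k * Y\<^sup>2"
    proof -
      have "exp (4 + 2 / \<sigma>) = exp (2 + 2 / \<sigma>) * exp 2"
        by (simp add: exp_add[symmetric])
      moreover have "?Lh * Y\<^sup>2 / (?Lh * exp (- (2 + 2 / \<sigma>))) = Y\<^sup>2 * exp (2 + 2 / \<sigma>)"
        unfolding exp_minus using Lh by (simp add: field_simps)
      ultimately show ?thesis by (simp add: k_def mult_ac)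
    qed
    finally have "posterior \<sigma> S n X (empirical_prior S c \<delta> (\<theta>hat X)) A \<le> ennreal (sqrt k * Y)"
      using k0 Y by (intro le_ennreal_sqrt_mult posterior_le_1) (auto simp: A_def)
    also have "\<dots> = ennreal (sqrt k) * (\<Sum>g\<in>G. ennreal (y g X))"
      using k0 Y y_nonneg by (simp add: ennreal_mult Y_def sum_ennreal)
    also have "(\<Sum>g\<in>G. ennreal (y g X)) = (\<Sum>g\<in>G. \<Prod>i<n. ennreal (sqrt (u g (X i) / p (X i))))"
      unfolding y_def using ratio_nonneg
      by (intro sum.cong refl prod_ennreal[symmetric]) simp
    finally show ?thesis .
  qed
  have affinity: "(\<integral>\<^sup>+x. ennreal (sqrt (u g x * p x)) \<partial>lborel) \<le> ennreal (exp (- (t\<^sup>2 / 2)))"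
    if g: "g \<in> G" for g
  proof -
    obtain \<theta> where \<theta>: "\<theta> \<in> param_space S" "hellinger p (mixture \<sigma> S \<theta>) > t" "near_grid m S g \<theta>"
      using g by (auto simp: G_def A_def)
    let ?I = "exp (2 * (1 / real m) / \<sigma>) * (\<Sum>s<S. fst g s)"
    have "(\<Sum>s<S. fst g s) \<le> (\<Sum>s<S. fst \<theta> s + 1 / real m)"
      using \<theta>(3) by (intro sum_mono) (auto simp: near_grid_def)
    also have "\<dots> = 1 + real S / real m"
      using param_space_sum[OF \<theta>(1)] by (simp add: sum.distrib)
    finally have "?I \<le> exp (2 / (real m * \<sigma>)) * (1 + real S / real m)"
      by simp
    then have "l * (?I - 1) + 1 / l \<le> t\<^sup>2"
      using err \<open>0 < l\<close> by (smt (verit) mult_left_mono)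
    moreover have "t\<^sup>2 \<le> (hellinger p (mixture \<sigma> S \<theta>))\<^sup>2"
      using \<theta>(2) \<open>0 \<le> t\<close> by (intro power_mono) auto
    moreover have "1 + - (t\<^sup>2 / 2) \<le> exp (- (t\<^sup>2 / 2))" by (rule exp_ge_add_one_self)
    ultimately have "1 - (hellinger p (mixture \<sigma> S \<theta>))\<^sup>2 + (l * (?I - 1) + 1 / l) / 2 \<le> exp (- (t\<^sup>2 / 2))"
      by argo
    moreover have "(\<integral>\<^sup>+x. ennreal (sqrt (u g x * p x)) \<partial>lborel)
        \<le> ennreal (1 - (hellinger p (mixture \<sigma> S \<theta>))\<^sup>2 + (l * (?I - 1) + 1 / l) / 2)"
    proof (rule affinity_le_hellinger[OF p_int])
      show "has_bochner_integral lborel (mixture \<sigma> S \<theta>) 1"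
        using has_bochner_integral_mixture[OF assms(1), of S \<theta>] param_space_sum[OF \<theta>(1)] by simp
      show "has_bochner_integral lborel (u g) ?I"
        unfolding u_def by (intro has_bochner_integral_mult_right has_bochner_integral_mixture assms(1))
    qed (use p_pos mixture_pos[OF assms(1) \<theta>(1)] le_u[OF \<theta>(1,3)] \<open>0 < l\<close> in \<open>auto intro: less_imp_le\<close>)
    ultimately show ?thesis by (meson ennreal_leI order_trans)
  qed
  have "(\<integral>\<^sup>+X. posterior \<sigma> S n X (empirical_prior S c \<delta> (\<theta>hat X)) A \<partial>sample_measure p n)
      \<le> (\<integral>\<^sup>+X. ennreal (sqrt k) * (\<Sum>g\<in>G. \<Prod>i<n. ennreal (sqrt (u g (X i) / p (X i)))) \<partial>sample_measure p n)"
    by (intro nn_integral_mono pointwise)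
  also have "\<dots> = ennreal (sqrt k) * (\<Sum>g\<in>G. \<integral>\<^sup>+X. (\<Prod>i<n. ennreal (sqrt (u g (X i) / p (X i)))) \<partial>sample_measure p n)"
  proof -
    have meas [measurable]: "(\<lambda>X. \<Prod>i<n. ennreal (sqrt (u g (X i) / p (X i)))) \<in> borel_measurable (sample_measure p n)" for g
      unfolding sample_measure_def by measurable
    show ?thesis by (subst nn_integral_cmult, measurable, subst nn_integral_sum) (auto intro: meas)
  qed
  also have "\<dots> = ennreal (sqrt k) * (\<Sum>g\<in>G. (\<integral>\<^sup>+x. ennreal (sqrt (u g x * p x)) \<partial>lborel) ^ n)"
    using p_int p_pos by (subst nn_integral_prod_sqrt_ratio) auto
  also have "\<dots> \<le> ennreal (sqrt k) * (\<Sum>g\<in>G. ennreal (exp (- (t\<^sup>2 / 2))) ^ n)"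
    by (intro mult_left_mono sum_mono power_mono affinity) auto
  also have "\<dots> = ennreal (sqrt k * real (card G) * exp (- (real n * t\<^sup>2 / 2)))"
    using k0
    by (simp add: ennreal_power ennreal_mult exp_of_nat_mult[symmetric] ennreal_of_nat_eq_real_of_nat mult.assoc)
  also have "\<dots> \<le> ennreal (sqrt k * real (card (grid m L S)) * exp (- (real n * t\<^sup>2 / 2)))"
  proof -
    have "card G \<le> card (grid m L S)" unfolding G_def by (intro card_mono finite_grid) auto
    then show ?thesis using k0 by (intro ennreal_leI mult_right_mono mult_left_mono) auto
  qed
  finally show ?thesis by (simp add: p_def A_def k_def)
qed

section \<open>Asymptotics\<close>

text \<open>With x = n, the root of x^(3 S) x^S is x^(2 S); the grid adds x^(11 S). The total x^(13
  S) is at most exp (13 C ln^2 n), and the condition on \<open>M\<close> leaves a surplus of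
  \<open>exp (- (ln (real n))\<^sup>2)\<close>.\<close>

lemma covering_bound:
  fixes n S :: nat and c d M \<sigma> C :: real
  assumes "2 \<le> n" and "S \<ge> 1" and "0 \<le> c" and "0 \<le> d"
    and cS: "c * real S \<le> real n ^ 3" and d: "real n * d \<le> real n"
    and "0 \<le> card0" and card: "card0 \<le> (real n ^ 11) ^ S"
    and S: "real S \<le> C * ln (real n)" and M: "13 * C + 1 \<le> M\<^sup>2 / 2"
  shows "sqrt (exp (4 + 2 / \<sigma>) * (c * real S) ^ (S - 1) * (real n * d) ^ S) * card0
      * exp (- (M\<^sup>2 / 2 * (ln (real n))\<^sup>2))
    \<le> exp (2 + 1 / \<sigma>) * exp (- (ln (real n))\<^sup>2)"
proof -
  define x where "x = real n"
  have x: "x \<ge> 1" using assms(1) by (simp add: x_def)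
  have "(c * real S) ^ (S - 1) \<le> (x ^ 3) ^ (S - 1)"
    using cS assms(3) by (intro power_mono) (auto simp: x_def)
  also have "\<dots> \<le> (x ^ 3) ^ S" using x by (intro power_increasing) auto
  finally have 1: "(c * real S) ^ (S - 1) \<le> (x ^ 3) ^ S" .
  have 2: "(real n * d) ^ S \<le> x ^ S" using d assms(4) by (intro power_mono) (auto simp: x_def)
  have "exp (4 + 2 / \<sigma>) * (c * real S) ^ (S - 1) * (real n * d) ^ S \<le> exp (4 + 2 / \<sigma>) * (x ^ 3) ^ S * x ^ S"
    using 1 2 assms(3,4) x by (intro mult_mono mult_nonneg_nonneg) auto
  also have "\<dots> = (exp (2 + 1 / \<sigma>) * (x ^ 2) ^ S)\<^sup>2"
    by (simp add: power_mult_distrib exp_of_nat_mult[symmetric] power_mult[symmetric]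
        power_add[symmetric] algebra_simps flip: exp_double)
  finally have "sqrt (exp (4 + 2 / \<sigma>) * (c * real S) ^ (S - 1) * (real n * d) ^ S)
      \<le> exp (2 + 1 / \<sigma>) * (x ^ 2) ^ S"
    by (rule real_le_lsqrt[rotated]) (use x in simp)
  then have "sqrt (exp (4 + 2 / \<sigma>) * (c * real S) ^ (S - 1) * (real n * d) ^ S) * card0
      \<le> (exp (2 + 1 / \<sigma>) * (x ^ 2) ^ S) * (x ^ 11) ^ S"
    using card \<open>0 \<le> card0\<close> x by (intro mult_mono) (auto simp: x_def)
  also have "\<dots> = exp (2 + 1 / \<sigma>) * x ^ (13 * S)"
    by (simp add: power_mult[symmetric] power_add[symmetric] mult.commute)
  also have "x ^ (13 * S) = exp (real (13 * S) * ln x)"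
    unfolding exp_of_nat_mult using x by simp
  also have "real (13 * S) * ln x \<le> 13 * C * (ln x)\<^sup>2"
    using mult_right_mono[OF S, of "ln x"] x by (simp add: x_def power2_eq_square mult_ac)
  finally have "sqrt (exp (4 + 2 / \<sigma>) * (c * real S) ^ (S - 1) * (real n * d) ^ S) * card0
      \<le> exp (2 + 1 / \<sigma>) * exp (13 * C * (ln x)\<^sup>2)"
    by simp
  then have "sqrt (exp (4 + 2 / \<sigma>) * (c * real S) ^ (S - 1) * (real n * d) ^ S) * card0
        * exp (- (M\<^sup>2 / 2 * (ln x)\<^sup>2))
      \<le> exp (2 + 1 / \<sigma>) * exp (13 * C * (ln x)\<^sup>2) * exp (- (M\<^sup>2 / 2 * (ln x)\<^sup>2))"
    by (intro mult_right_mono) auto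
  also have "\<dots> = exp (2 + 1 / \<sigma>) * exp (13 * C * (ln x)\<^sup>2 - M\<^sup>2 / 2 * (ln x)\<^sup>2)"
    by (simp only: mult.assoc exp_add diff_conv_add_uminus)
  also have "13 * C * (ln x)\<^sup>2 - M\<^sup>2 / 2 * (ln x)\<^sup>2 \<le> - (ln x)\<^sup>2"
    using mult_right_mono[OF M, of "(ln x)\<^sup>2"] by (simp add: algebra_simps)
  finally show ?thesis by (simp add: x_def)
qed

text \<open>For grid resolution n^4 the excess mass is O(ln n / n^4). With l = n^2 both error terms
  are O(ln n / n^2), negligible against ln^2 n / n.\<close>

lemma eventually_covering_error:
  fixes C M \<sigma> :: real
  assumes "\<sigma> > 0" and "C > 0" and "M > 0"
  shows "eventually (\<lambda>n. real n ^ 2 * (exp (2 / (real n ^ 4 * \<sigma>)) * (1 + C * ln (real n) / real n ^ 4) - 1)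
      + 1 / real n ^ 2 \<le> (M * (ln (real n) / sqrt (real n)))\<^sup>2) at_top"
  using assms by real_asymp

theorem mainTheorem4:
  fixes \<sigma> \<kappa>S \<kappa>B \<kappa>\<delta> :: real
    and K :: nat and \<theta>star :: param and pstar :: "real \<Rightarrow> real"
    and S :: "nat \<Rightarrow> nat" and B c \<delta> :: "nat \<Rightarrow> real"
    and \<theta>hat :: "nat \<Rightarrow> (nat \<Rightarrow> real) \<Rightarrow> param"
  assumes "\<sigma> > 0"
    and "\<theta>star \<in> param_space K"
    and "pstar = mixture \<sigma> K \<theta>star"
    and "\<kappa>S > 0" and "\<And>n. \<bar>real (S n) - \<kappa>S * (real n * (rate n)\<^sup>2 / ln (real n))\<bar> < 1"
    and "\<kappa>B > 0" and "\<And>n. B n = \<kappa>B * sqrt (ln (1 / rate n))"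
    and "\<And>n. c n = real n / (rate n)\<^sup>2"
    and "\<kappa>\<delta> > 0" and "\<And>n. \<delta> n = \<kappa>\<delta> * rate n"
    and "\<And>n. S n \<ge> 1 \<Longrightarrow> mle_estimator \<sigma> (S n) (B n) pstar n (\<theta>hat n)"
  shows "\<exists>M>0. (\<lambda>n. \<integral>\<^sup>+X. posterior \<sigma> (S n) n X
                         (empirical_prior (S n) (c n) (\<delta> n) (\<theta>hat n X))
                         {\<theta> \<in> param_space (S n).
                            hellinger pstar (mixture \<sigma> (S n) \<theta>) > M * rate n}
                       \<partial>sample_measure pstar n) \<longlonglongrightarrow> 0"
proof -
  \<comment> \<open>The extra 1 absorbs the rounding of \<open>S n\<close> once ln n \<ge>
    1.\<close>
  define C where "C = \<kappa>S + 1"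
  \<comment> \<open>Since M > 2, M^2 / 2 exceeds M, which in turn exceeds 13 C + 1.\<close>
  define M where "M = 13 * C + 2"
  have C: "C > 1" using assms(4) by (simp add: C_def)
  have M: "M > 2" using C by (simp add: M_def)
  have C0: "0 < C" and M0: "0 < M" using C M by simp_all
  have M2: "13 * C + 1 \<le> M\<^sup>2 / 2"
  proof -
    have "2 * M \<le> M * M" using M by (intro mult_right_mono) auto
    then show ?thesis by (simp add: M_def power2_eq_square)
  qed
  obtain b where b: "\<And>s. s < K \<Longrightarrow> \<bar>snd \<theta>star s\<bar> \<le> b"
  proof
    show "\<bar>snd \<theta>star s\<bar> \<le> (\<Sum>s<K. \<bar>snd \<theta>star s\<bar>)" if "s < K" for s
      using that by (intro member_le_sum) auto
  qed
  have nrate: "real n * (rate n)\<^sup>2 / ln (real n) = ln (real n)" if "2 \<le> n" for n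
    using that by (simp add: rate_def power_divide power2_eq_square)
  have ev: "\<forall>\<^sub>F n in sequentially. 2 \<le> n \<and> 1 \<le> ln (real n) \<and> real K + 1 \<le> \<kappa>S * ln (real n) - 1
      \<and> max b 0 \<le> B n \<and> 2 \<le> c n \<and> real n \<le> c n \<and> 1 / real n \<le> \<delta> n \<and> B n + \<delta> n \<le> real n
      \<and> \<delta> n \<le> 1 \<and> c n \<le> real n ^ 2 \<and> C * ln (real n) \<le> real n
      \<and> (real n ^ 4 + 1) * (2 * (real n ^ 5 + 1) + 1) \<le> real n ^ 11"
    unfolding eventually_conj_iff
  proof (intro conjI)
    show "\<forall>\<^sub>F n in sequentially. 2 \<le> n" by (rule eventually_ge_at_top)
    show "\<forall>\<^sub>F n in sequentially. 1 \<le> ln (real n)" by real_asymp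
    show "\<forall>\<^sub>F n in sequentially. real K + 1 \<le> \<kappa>S * ln (real n) - 1"
      using assms(4) by real_asymp
    have "filterlim B at_top sequentially"
      unfolding assms(7)[abs_def] rate_def using assms(6) by real_asymp
    then show "\<forall>\<^sub>F n in sequentially. max b 0 \<le> B n" by (rule filterlim_at_top[THEN iffD1, rule_format])
    show "\<forall>\<^sub>F n in sequentially. 2 \<le> c n" unfolding assms(8) rate_def by real_asymp
    show "\<forall>\<^sub>F n in sequentially. real n \<le> c n" unfolding assms(8) rate_def by real_asymp
    show "\<forall>\<^sub>F n in sequentially. 1 / real n \<le> \<delta> n"
      unfolding assms(10) rate_def using assms(9) by real_asymp
    show "\<forall>\<^sub>F n in sequentially. B n + \<delta> n \<le> real n"
      unfolding assms(7,10) rate_def using assms(6,9) by real_asymp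
    show "\<forall>\<^sub>F n in sequentially. \<delta> n \<le> 1"
      unfolding assms(10) rate_def using assms(9) by real_asymp
    show "\<forall>\<^sub>F n in sequentially. c n \<le> real n ^ 2" unfolding assms(8) rate_def by real_asymp
    show "\<forall>\<^sub>F n in sequentially. C * ln (real n) \<le> real n" using C by real_asymp
    show "\<forall>\<^sub>F n in sequentially. (real n ^ 4 + 1) * (2 * (real n ^ 5 + 1) + 1) \<le> real n ^ 11"
      by real_asymp
  qed
  let ?E = "\<lambda>n. \<integral>\<^sup>+X. posterior \<sigma> (S n) n X
                         (empirical_prior (S n) (c n) (\<delta> n) (\<theta>hat n X))
                         {\<theta> \<in> param_space (S n).
                            hellinger pstar (mixture \<sigma> (S n) \<theta>) > M * rate n}
                       \<partial>sample_measure pstar n"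
  have "\<forall>\<^sub>F n in sequentially. ?E n \<le> ennreal (exp (2 + 1 / \<sigma>) * exp (- (ln (real n))\<^sup>2))"
    using ev eventually_covering_error[OF assms(1) C0 M0]
  proof eventually_elim
    case (elim n)
    have n: "2 \<le> n" and lnn: "1 \<le> ln (real n)" using elim by auto
    have S: "\<bar>real (S n) - \<kappa>S * ln (real n)\<bar> < 1" using assms(5)[of n] nrate[OF n] by simp
    have SK: "K \<le> S n" "1 \<le> S n" using S elim by linarith+
    have SC: "real (S n) \<le> C * ln (real n)" using S lnn by (simp add: C_def algebra_simps)
    \<comment> \<open>The choices are m = n^4 and l = n^2; \<open>C * ln (real n)\<close> stands in
      for the number of components.\<close>
    have err: "real n ^ 2 * (exp (2 / (real (n ^ 4) * \<sigma>)) * (1 + real (S n) / real (n ^ 4)) - 1)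
        + 1 / real n ^ 2 \<le> (M * rate n)\<^sup>2"
    proof -
      have "exp (2 / (real n ^ 4 * \<sigma>)) * (1 + real (S n) / real n ^ 4)
          \<le> exp (2 / (real n ^ 4 * \<sigma>)) * (1 + C * ln (real n) / real n ^ 4)"
        using SC by (intro mult_left_mono add_left_mono divide_right_mono) auto
      then have "real n ^ 2 * (exp (2 / (real n ^ 4 * \<sigma>)) * (1 + real (S n) / real n ^ 4) - 1)
          \<le> real n ^ 2 * (exp (2 / (real n ^ 4 * \<sigma>)) * (1 + C * ln (real n) / real n ^ 4) - 1)"
        by (intro mult_left_mono) auto
      moreover have "real n ^ 2 * (exp (2 / (real n ^ 4 * \<sigma>)) * (1 + C * ln (real n) / real n ^ 4) - 1)
          + 1 / real n ^ 2 \<le> (M * rate n)\<^sup>2"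
        using elim C M by (simp add: rate_def)
      ultimately show ?thesis by simp
    qed
    \<comment> \<open>From \<open>B n + \<delta> n \<le> real n\<close>, the extent L = n^5 + 1
      suffices at resolution n^4.\<close>
    have L: "real (n ^ 4) * (B n + \<delta> n) + 1 \<le> real (n ^ 5 + 1)"
    proof -
      have "real n ^ 4 * (B n + \<delta> n) \<le> real n ^ 4 * real n"
        using elim by (intro mult_left_mono) auto
      then show ?thesis by (simp add: power_Suc2[symmetric] del: power_Suc2)
    qed
    have rate0: "0 \<le> M * rate n" using M lnn by (simp add: rate_def)
    have "?E n \<le> ennreal (sqrt (exp (4 + 2 / \<sigma>) * (c n * real (S n)) ^ (S n - 1) * (real n * \<delta> n) ^ S n)
        * real (card (grid (n ^ 4) (n ^ 5 + 1) (S n))) * exp (- (real n * (M * rate n)\<^sup>2 / 2)))"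
      unfolding assms(3)
    proof (rule expected_posterior_le[where B = "B n" and l = "real n ^ 2"])
      show "\<bar>snd \<theta>star s\<bar> \<le> B n" if "s < K" for s
        using b[OF that] elim by linarith
      show "mle_estimator \<sigma> (S n) (B n) (mixture \<sigma> K \<theta>star) n (\<theta>hat n)"
        using assms(11) SK assms(3) by simp
    qed (use assms(1,2) SK elim L err rate0 n in auto)
    also have "real n * (M * rate n)\<^sup>2 / 2 = M\<^sup>2 / 2 * (ln (real n))\<^sup>2"
      using n by (simp add: rate_def power_mult_distrib power_divide)
    also have "sqrt (exp (4 + 2 / \<sigma>) * (c n * real (S n)) ^ (S n - 1) * (real n * \<delta> n) ^ S n)
        * real (card (grid (n ^ 4) (n ^ 5 + 1) (S n))) * exp (- (M\<^sup>2 / 2 * (ln (real n))\<^sup>2))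
        \<le> exp (2 + 1 / \<sigma>) * exp (- (ln (real n))\<^sup>2)"
    proof (rule covering_bound[OF n SK(2) _ _ _ _ _ _ SC M2])
      show "0 \<le> c n" "0 \<le> \<delta> n" using elim by (auto intro: order_trans[of 0 "1 / real n"])
      have "c n * real (S n) \<le> real n ^ 2 * real n"
        using elim SC by (intro mult_mono) auto
      then show "c n * real (S n) \<le> real n ^ 3" by (simp add: power3_eq_cube power2_eq_square)
      show "real n * \<delta> n \<le> real n" using elim by (simp add: mult_left_le)
      have "real (card (grid (n ^ 4) (n ^ 5 + 1) (S n))) \<le> real (((n ^ 4 + 1) * (2 * (n ^ 5 + 1) + 1)) ^ S n)"
        using card_grid_le by (rule of_nat_mono)
      also have "\<dots> = ((real n ^ 4 + 1) * (2 * (real n ^ 5 + 1) + 1)) ^ S n"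
        by (simp only: of_nat_power of_nat_mult of_nat_add of_nat_1 of_nat_numeral)
      also have "\<dots> \<le> (real n ^ 11) ^ S n"
        using elim by (intro power_mono) auto
      finally show "real (card (grid (n ^ 4) (n ^ 5 + 1) (S n))) \<le> (real n ^ 11) ^ S n" .
    qed simp
    finally show ?case by (simp add: ennreal_leI)
  qed
  moreover have "(\<lambda>n. ennreal (exp (2 + 1 / \<sigma>) * exp (- (ln (real n))\<^sup>2))) \<longlonglongrightarrow> 0"
  proof -
    have "(\<lambda>n. exp (2 + 1 / \<sigma>) * exp (- (ln (real n))\<^sup>2)) \<longlonglongrightarrow> 0" by real_asymp
    then show ?thesis using tendsto_ennrealI by fastforce
  qed
  ultimately have "?E \<longlonglongrightarrow> 0"
    by (intro tendsto_sandwich[of "\<lambda>_. 0" ?E sequentially]) auto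
  then show ?thesis using M by (intro exI[of _ M]) auto
qed

end
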